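(* In the setting described in the context, suppose there exist observer gains $L_1,\dots,L_N$ such that the block matrix $$A_c=\begin{bmatrix}\Theta_1 & -\tilde B_2K_2 & \cdots & -\tilde B_NK_N\\ -\tilde B_1K_1 & \Theta_2 & \cdots & -\tilde B_NK_N\\ \vdots & \vdots & \ddots & \vdots\\ -\tilde B_1K_1 & \cdots & -\tilde B_{N-1}K_{N-1} & \Theta_N\end{bmatrix},\qquad \Theta_i=\tilde A+\tilde BK-\tilde B_iK_i-L_iH_i,$$ (i.e. the $i$-th diagonal block is $\Theta_i$ and the $(i,l)$ block, $l\ne i$, is $-\tilde B_lK_l$) is asymptotically stable (spectral radius $<1$), and use these gains in the observers. Then the observers are asymptotically stable, i.e. for all initial conditions and every $i=1,\dots,N$, $$\lim_{k\to\infty}\|\hat E_i(k)-E(k)\|=0 .$$ Moreover, if the Riccati equation has a positive definite solution $P$ (the solution used to define $K$), then under the distributed controllers $u_i(k)=\tilde u_i(k)+\bar u_i^*(k)$ the multi-agent system achieves leader-follower consensus, i.e. for all initial conditions $$\lim_{k\to\infty}\|x_i(k)-x_0(k)\|=0,\qquad i=1,\dots,N.$$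
   Context: **Agents and graph.** There are $N$ followers $x_i(k+1)=A_ix_i(k)+B_iu_i(k)$, $i=1,\dots,N$, with $x_i(k)\in\mathbb R^n$, $u_i(k)\in\mathbb R^m$, $A_i\in\mathbb R^{n\times n}$, $B_i\in\mathbb R^{n\times m}$, and a leader $x_0(k+1)=A_0x_0(k)$ with $x_0(k)\in\mathbb R^n$, $A_0\in\mathbb R^{n\times n}$; by convention $B_0=0$ (and $u_0=0$). The agents $0,1,\dots,N$ interact over a directed graph $\mathcal G$; $\mathcal N_i$ denotes the set of neighbours of $i$, whose state and input agent $i$ can use. Standing assumption: $\mathcal G$ has a spanning tree with root $0$. Fix such a spanning tree; for each follower $i$ let $j=j(i)\in\mathcal N_i$ be its parent in the tree. Only the edges of this tree are used. **Errors and feedforward.** Put $e_{ij}(k)=x_i(k)-x_j(k)$ for $j=j(i)$. The control is $u_i(k)=\tilde u_i(k)+\bar u_i(k)$, where the feedforward part $\tilde u_i$ is given, with $j=j(i)$, by one of: - Case 1 ($B_i$ invertible): $\tilde u_i(k)=-B_i^{-1}(A_i-A_j)x_j(k)+B_i^{-1}B_ju_j(k)$; - Case 2 (the range of $[A_j-A_i,\ B_j]$ is contained in the range of $B_i$): $\tilde u_i(k)=-B_i^{\dagger}[(A_i-A_j)x_j(k)-B_ju_j(k)]+(I-B_i^{\dagger}B_i)z(k)$ with $z(k)$ arbitrary, where $\dagger$ is the Moore-Penrose inverse. It is assumed that each follower is in Case 1 or Case 2. Then $e_{ij}(k+1)=A_ie_{ij}(k)+B_i\bar u_i(k)$. **Global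 error system.** Let $E(k)\in\mathbb R^{nN}$ be the stack, for $i=1,\dots,N$, of the vectors $e_{i\,j(i)}(k)$; $\bar u(k)$ the stack of $\bar u_1(k),\dots,\bar u_N(k)$; $\tilde A=\mathrm{diag}\{A_1,\dots,A_N\}$, $\tilde B=\mathrm{diag}\{B_1,\dots,B_N\}$ (block diagonal), and $\tilde B_i$ the $i$-th block column of $\tilde B$ (so $\tilde B_i$ has $B_i$ in the $i$-th block and zeros elsewhere). Then $E(k+1)=\tilde AE(k)+\sum_{i=1}^N\tilde B_i\bar u_i(k)$. Agent $i$ measures $Y_i(k)=H_iE(k)$, where $H_i$ is a given matrix composed of blocks $0$ and $I_n$ determined by the interaction among agents. **Feedback gain.** Let $Q\ge0$ ($n\times n$) and $R_i>0$ ($m\times m$) be symmetric weights, $\mathcal Q=I_N\otimes Q$, $R=\mathrm{diag}\{R_1,\dots,R_N\}$. Let $P$ be a symmetric solution (with $R+\tilde B^TP\tilde B$ invertible) of the Riccati equation $$P=\tilde A^TP\tilde A+\mathcal Q-\tilde A^TP\tilde B(R+\tilde B^TP\tilde B)^{-1}\tilde B^TP\tilde A,$$ let $K=-(R+\tilde B^TP\tilde B)^{-1}\tilde B^TP\tilde A$, and let $K_i$ be the $i$-th block row ($m$ rows) of $K$. **Distributed feedback and observers.** $\bar u_i(k)=\bar u_i^*(k)=K_i\hat E_i(k)$, where, for $i=1,\dots,N$, $$\hat E_i(k+1)=\tilde A\hat E_i(k)+\tilde B_i\bar u_i^*(k)+\sum_{l\ne i}\tilde B_lK_l\hat E_i(k)+L_i\bigl(Y_i(k)-H_i\hat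 E_i(k)\bigr)$$ with observer gain matrices $L_i$.
   Formalization: The consensus part additionally assumes that every pair (A_i, B_i), i=1,…,N, is stabilizable; without this it fails (e.g. N=n=m=1, A_0=A_1=1, B_1=0, Q=0, R_1=P=1, H_1=L_1=1), and the condition is necessary for consensus. *)

theory Defs
  imports "Jordan_Normal_Form.Spectral_Radius" "Jordan_Normal_Form.Gauss_Jordan_Elimination"
begin

text \<open>Agents are numbered \<open>0, \<dots>, N\<close>, with \<open>0\<close> the leader; block indices in this theory
  therefore start at 1, whereas the entries of vectors and matrices are indexed from 0.\<close>

definition euclid_norm :: "real vec \<Rightarrow> real" where
  "euclid_norm v = sqrt (v \<bullet> v)"

definition schur_stable :: "real mat \<Rightarrow> bool" where
  "schur_stable M \<longleftrightarrow> spectral_radius (map_mat complex_of_real M) < 1"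

definition sym_pos_def :: "nat \<Rightarrow> real mat \<Rightarrow> bool" where
  "sym_pos_def n M \<longleftrightarrow> M \<in> carrier_mat n n \<and> M\<^sup>T = M \<and>
     (\<forall>v \<in> carrier_vec n. v \<noteq> 0\<^sub>v n \<longrightarrow> 0 < v \<bullet> (M *\<^sub>v v))"

definition sym_pos_semidef :: "nat \<Rightarrow> real mat \<Rightarrow> bool" where
  "sym_pos_semidef n M \<longleftrightarrow> M \<in> carrier_mat n n \<and> M\<^sup>T = M \<and>
     (\<forall>v \<in> carrier_vec n. 0 \<le> v \<bullet> (M *\<^sub>v v))"

text \<open>Meaningful for invertible square matrices only.\<close>

definition inv_mat :: "real mat \<Rightarrow> real mat" where
  "inv_mat M = the (mat_inverse M)"

definition mat_range :: "real mat \<Rightarrow> real vec set" where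
  "mat_range M = (\<lambda>v. M *\<^sub>v v) ` carrier_vec (dim_col M)"

text \<open>The four Penrose equations, which determine the Moore-Penrose inverse \<open>X\<close> of \<open>M\<close> uniquely.\<close>

definition is_moore_penrose :: "real mat \<Rightarrow> real mat \<Rightarrow> bool" where
  "is_moore_penrose M X \<longleftrightarrow> X \<in> carrier_mat (dim_col M) (dim_row M) \<and>
     M * X * M = M \<and> X * M * X = X \<and> (M * X)\<^sup>T = M * X \<and> (X * M)\<^sup>T = X * M"

text \<open>Horizontal concatenation \<open>[M, M']\<close>.\<close>

definition hconcat :: "real mat \<Rightarrow> real mat \<Rightarrow> real mat" where
  "hconcat M M' = four_block_mat M M' (0\<^sub>m 0 (dim_col M)) (0\<^sub>m 0 (dim_col M'))"

definition block_diag :: "nat \<Rightarrow> (nat \<Rightarrow> real mat) \<Rightarrow> real mat" where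
  "block_diag N F = diag_block_mat (map F [1..<Suc N])"

text \<open>The matrix with \<open>p \<times> q\<close> blocks of size \<open>r \<times> c\<close>, the block in position \<open>(i, l)\<close> being \<open>F i l\<close>.\<close>

definition block_mat :: "nat \<Rightarrow> nat \<Rightarrow> nat \<Rightarrow> nat \<Rightarrow> (nat \<Rightarrow> nat \<Rightarrow> real mat) \<Rightarrow> real mat" where
  "block_mat p q r c F =
     mat (p * r) (q * c) (\<lambda>(a, b). F (Suc (a div r)) (Suc (b div c)) $$ (a mod r, b mod c))"

definition block_vec :: "nat \<Rightarrow> nat \<Rightarrow> (nat \<Rightarrow> real vec) \<Rightarrow> real vec" where
  "block_vec N n v = vec (N * n) (\<lambda>a. v (Suc (a div n)) $ (a mod n))"

text \<open>The \<open>i\<close>-th block of \<open>m\<close> consecutive columns (rows).\<close>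

definition block_col :: "nat \<Rightarrow> real mat \<Rightarrow> nat \<Rightarrow> real mat" where
  "block_col m M i = mat (dim_row M) m (\<lambda>(a, b). M $$ (a, (i - 1) * m + b))"

definition block_row :: "nat \<Rightarrow> real mat \<Rightarrow> nat \<Rightarrow> real mat" where
  "block_row m M i = mat m (dim_col M) (\<lambda>(a, b). M $$ ((i - 1) * m + a, b))"

text \<open>An arc \<open>(j, i)\<close> of the graph means that \<open>i\<close> can use the data of \<open>j\<close>.\<close>

definition neighbours :: "(nat \<times> nat) set \<Rightarrow> nat \<Rightarrow> nat set" where
  "neighbours G i = {j. (j, i) \<in> G}"

text \<open>A spanning tree with root 0 is given by its parent map: its arcs are \<open>(par i, i)\<close> for the
  followers \<open>i\<close>, so that every follower has exactly one parent and the root has none, and all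
  followers can be reached from the root.\<close>

definition rooted_spanning_tree :: "nat \<Rightarrow> (nat \<times> nat) set \<Rightarrow> (nat \<Rightarrow> nat) \<Rightarrow> bool" where
  "rooted_spanning_tree N G par \<longleftrightarrow>
     (\<forall>i \<in> {1..N}. par i \<in> neighbours G i \<and> (0, i) \<in> {(par l, l) | l. l \<in> {1..N}}\<^sup>*)"

text \<open>A positive definite solution of the Riccati equation with merely positive semidefinite state
  weight does not by itself make the closed loop stable: with scalar \<open>A = 1\<close>, \<open>B = 0\<close>, \<open>Q = 0\<close>, \<open>R = 1\<close>
  every \<open>P > 0\<close> is a solution, and \<open>K = 0\<close>. Stabilizability of the pairs \<open>(A i, B i)\<close>, which holds
  whenever \<open>B i\<close> is invertible and is necessary for consensus, excludes this.\<close>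

definition stabilizable :: "nat \<Rightarrow> nat \<Rightarrow> real mat \<Rightarrow> real mat \<Rightarrow> bool" where
  "stabilizable n m A B \<longleftrightarrow> (\<exists>F \<in> carrier_mat m n. schur_stable (A + B * F))"

definition riccati_solution :: "real mat \<Rightarrow> real mat \<Rightarrow> real mat \<Rightarrow> real mat \<Rightarrow> real mat \<Rightarrow> bool" where
  "riccati_solution A B Q R P \<longleftrightarrow>
     P = A\<^sup>T * P * A + Q - A\<^sup>T * P * B * inv_mat (R + B\<^sup>T * P * B) * B\<^sup>T * P * A"

definition riccati_gain :: "real mat \<Rightarrow> real mat \<Rightarrow> real mat \<Rightarrow> real mat \<Rightarrow> real mat" where
  "riccati_gain A B R P = - (inv_mat (R + B\<^sup>T * P * B) * B\<^sup>T * P * A)"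

definition Theta :: "real mat \<Rightarrow> real mat \<Rightarrow> real mat \<Rightarrow> nat \<Rightarrow> (nat \<Rightarrow> real mat) \<Rightarrow> (nat \<Rightarrow> real mat) \<Rightarrow> nat \<Rightarrow> real mat" where
  "Theta At Bt K m L H i = At + Bt * K - block_col m Bt i * block_row m K i - L i * H i"

definition observer_error_mat :: "nat \<Rightarrow> nat \<Rightarrow> nat \<Rightarrow> real mat \<Rightarrow> real mat \<Rightarrow> real mat \<Rightarrow> (nat \<Rightarrow> real mat) \<Rightarrow> (nat \<Rightarrow> real mat) \<Rightarrow> real mat" where
  "observer_error_mat N n m At Bt K L H =
     block_mat N N (N * n) (N * n)
       (\<lambda>i l. if l = i then Theta At Bt K m L H i else - (block_col m Bt l * block_row m K l))"

text \<open>Trajectories: \<open>x i k\<close> and \<open>u i k\<close> are the state and input of agent \<open>i\<close> at time \<open>k\<close>.\<close>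

definition agent_dynamics ::
  "nat \<Rightarrow> nat \<Rightarrow> nat \<Rightarrow> (nat \<Rightarrow> real mat) \<Rightarrow> (nat \<Rightarrow> real mat) \<Rightarrow>
   (nat \<Rightarrow> nat \<Rightarrow> real vec) \<Rightarrow> (nat \<Rightarrow> nat \<Rightarrow> real vec) \<Rightarrow> bool" where
  "agent_dynamics N n m A B x u \<longleftrightarrow>
     (\<forall>k. x 0 k \<in> carrier_vec n \<and> u 0 k = 0\<^sub>v m \<and> x 0 (Suc k) = A 0 *\<^sub>v x 0 k) \<and>
     (\<forall>i \<in> {1..N}. \<forall>k. x i k \<in> carrier_vec n \<and> u i k \<in> carrier_vec m \<and>
        x i (Suc k) = A i *\<^sub>v x i k + B i *\<^sub>v u i k)"

definition feedforward1 ::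
  "(nat \<Rightarrow> real mat) \<Rightarrow> (nat \<Rightarrow> real mat) \<Rightarrow> (nat \<Rightarrow> nat \<Rightarrow> real vec) \<Rightarrow> (nat \<Rightarrow> nat \<Rightarrow> real vec) \<Rightarrow>
   nat \<Rightarrow> nat \<Rightarrow> (nat \<Rightarrow> real vec) \<Rightarrow> bool" where
  "feedforward1 A B x u i j ut \<longleftrightarrow> invertible_mat (B i) \<and>
     (\<forall>k. ut k = - (inv_mat (B i) *\<^sub>v ((A i - A j) *\<^sub>v x j k)) + inv_mat (B i) *\<^sub>v (B j *\<^sub>v u j k))"

definition feedforward2 ::
  "nat \<Rightarrow> (nat \<Rightarrow> real mat) \<Rightarrow> (nat \<Rightarrow> real mat) \<Rightarrow> (nat \<Rightarrow> nat \<Rightarrow> real vec) \<Rightarrow> (nat \<Rightarrow> nat \<Rightarrow> real vec) \<Rightarrow>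
   nat \<Rightarrow> nat \<Rightarrow> (nat \<Rightarrow> real vec) \<Rightarrow> bool" where
  "feedforward2 m A B x u i j ut \<longleftrightarrow>
     mat_range (hconcat (A j - A i) (B j)) \<subseteq> mat_range (B i) \<and>
     (\<exists>X z. is_moore_penrose (B i) X \<and>
       (\<forall>k. z k \<in> carrier_vec m \<and>
         ut k = - (X *\<^sub>v ((A i - A j) *\<^sub>v x j k - B j *\<^sub>v u j k)) + (1\<^sub>m m - X * B i) *\<^sub>v z k))"

definition stacked_error :: "nat \<Rightarrow> nat \<Rightarrow> (nat \<Rightarrow> nat) \<Rightarrow> (nat \<Rightarrow> nat \<Rightarrow> real vec) \<Rightarrow> nat \<Rightarrow> real vec" where
  "stacked_error N n par x k = block_vec N n (\<lambda>i. x i k - x (par i) k)"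

definition observer_dynamics ::
  "nat \<Rightarrow> nat \<Rightarrow> nat \<Rightarrow> real mat \<Rightarrow> real mat \<Rightarrow> real mat \<Rightarrow> (nat \<Rightarrow> real mat) \<Rightarrow> (nat \<Rightarrow> real mat) \<Rightarrow>
   (nat \<Rightarrow> nat \<Rightarrow> real vec) \<Rightarrow> (nat \<Rightarrow> real vec) \<Rightarrow> (nat \<Rightarrow> nat \<Rightarrow> real vec) \<Rightarrow> bool" where
  "observer_dynamics N n m At Bt K L H ub E Eh \<longleftrightarrow>
     (\<forall>i \<in> {1..N}. \<forall>k. Eh i k \<in> carrier_vec (N * n) \<and>
        Eh i (Suc k) = At *\<^sub>v Eh i k + block_col m Bt i *\<^sub>v ub i k
          + finsum_vec TYPE(real) (N * n)
              (\<lambda>l. block_col m Bt l *\<^sub>v (block_row m K l *\<^sub>v Eh i k)) ({1..N} - {i})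
          + L i *\<^sub>v (H i *\<^sub>v E k - H i *\<^sub>v Eh i k))"

text \<open>The closed loop of the agents and the observers; \<open>ut\<close> and \<open>ub\<close> are the feedforward and the
  feedback part of the inputs.\<close>

definition closed_loop ::
  "nat \<Rightarrow> nat \<Rightarrow> nat \<Rightarrow> (nat \<Rightarrow> real mat) \<Rightarrow> (nat \<Rightarrow> real mat) \<Rightarrow> (nat \<Rightarrow> nat) \<Rightarrow>
   real mat \<Rightarrow> (nat \<Rightarrow> real mat) \<Rightarrow> (nat \<Rightarrow> real mat) \<Rightarrow>
   (nat \<Rightarrow> nat \<Rightarrow> real vec) \<Rightarrow> (nat \<Rightarrow> nat \<Rightarrow> real vec) \<Rightarrow> bool" where
  "closed_loop N n m A B par K L H x Eh \<longleftrightarrow>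
     (\<exists>u ut ub.
        agent_dynamics N n m A B x u \<and>
        (\<forall>i \<in> {1..N}. feedforward1 A B x u i (par i) (ut i) \<or> feedforward2 m A B x u i (par i) (ut i)) \<and>
        (\<forall>i \<in> {1..N}. \<forall>k. ub i k = block_row m K i *\<^sub>v Eh i k \<and> u i k = ut i k + ub i k) \<and>
        observer_dynamics N n m (block_diag N A) (block_diag N B) K L H ub
          (stacked_error N n par x) Eh)"

end

theory Submission
  imports Defs
begin

text \<open>The feedforward cancels the coupling to the parent, so the stacked tracking error obeys
  \<open>E' = (A + B K) E + \<Sum>\<^sub>l B\<^sub>l K\<^sub>l \<epsilon>\<^sub>l\<close> with the observer errors \<open>\<epsilon>\<^sub>l\<close>, which in turn
  form an autonomous linear system with matrix \<open>A\<^sub>c\<close> and hence vanish. The matrix \<open>A + B K\<close> is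
  stable: with \<open>M = A + B K\<close>, the Riccati equation reads \<open>A\<^sup>T P M = P - Q\<close>, \<open>B\<^sup>T P M = - R K\<close>, so
  \<open>x \<mapsto> x\<^sup>T P x\<close> does not increase along \<open>M\<close>; for an eigenvector \<open>v\<close> of \<open>M\<close> with \<open>|\<lambda>| \<ge> 1\<close> this forces
  \<open>|\<lambda>| = 1\<close>, \<open>Q v = 0\<close> and \<open>K v = 0\<close>, whence \<open>A\<^sup>T P v = \<lambda>\<^sup>-\<^sup>1 P v\<close> and \<open>B\<^sup>T P v = 0\<close>. Some block of
  \<open>P v\<close> is then an uncontrollable mode of a single agent on the unit circle, against
  stabilizability. A stable system with vanishing input vanishes, and \<open>E \<rightarrow> 0\<close> propagates from
  the leader along the tree.\<close>

section \<open>Geometric decay and vanishing inputs\<close>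

text \<open>For \<open>0 < n\<close> the spectrum is nonempty, so the spectral radius is attained by
  an eigenvalue and stability can be tested on single eigenvalues.\<close>

lemma spectral_radius_less_iff:
  assumes M: "M \<in> carrier_mat n n" and n: "0 < n"
  shows "spectral_radius M < c \<longleftrightarrow> (\<forall>e. eigenvalue M e \<longrightarrow> norm e < c)"
  using spectral_radius_mem_max[OF M n] unfolding spectrum_def by force

text \<open>Both matrices have the same characteristic polynomial. This turns eigenvectors of the
  transpose into eigenvalues of the closed loop in \<open>stabilizable_modes\<close>.\<close>

lemma eigenvalue_transpose:
  fixes M :: "'a :: field mat"
  assumes M: "M \<in> carrier_mat n n"
  shows "eigenvalue M\<^sup>T e \<longleftrightarrow> eigenvalue M e"
  using M by (simp add: eigenvalue_root_char_poly[of _ n])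

lemma eigenvalue_smult:
  fixes M :: "'a :: field mat"
  assumes M: "M \<in> carrier_mat n n" and c: "c \<noteq> 0" and ev: "eigenvalue (c \<cdot>\<^sub>m M) e"
  shows "eigenvalue M (e / c)"
proof -
  from ev obtain v where v: "v \<in> carrier_vec n" "v \<noteq> 0\<^sub>v n" "(c \<cdot>\<^sub>m M) *\<^sub>v v = e \<cdot>\<^sub>v v"
    unfolding eigenvalue_def eigenvector_def using M by auto
  have "M *\<^sub>v v = (1 / c) \<cdot>\<^sub>v ((c \<cdot>\<^sub>m M) *\<^sub>v v)"
    using M v(1) c by (intro eq_vecI) auto
  also have "\<dots> = (e / c) \<cdot>\<^sub>v v" unfolding v(3) using v(1) by (simp add: smult_smult_assoc)
  finally show ?thesis
    unfolding eigenvalue_def eigenvector_def using M v by auto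
qed

lemma pow_smult_mat:
  fixes M :: "'a :: comm_ring_1 mat"
  assumes M: "M \<in> carrier_mat n n"
  shows "(c \<cdot>\<^sub>m M) ^\<^sub>m k = c ^ k \<cdot>\<^sub>m (M ^\<^sub>m k)"
proof (induction k)
  case 0
  then show ?case using M by (auto intro!: eq_matI)
next
  case (Suc k)
  have Mk: "M ^\<^sub>m k \<in> carrier_mat n n" using M by simp
  have "c ^ k \<cdot>\<^sub>m M ^\<^sub>m k * (c \<cdot>\<^sub>m M) = c ^ k \<cdot>\<^sub>m (c \<cdot>\<^sub>m (M ^\<^sub>m k * M))"
    by (simp add: mult_smult_assoc_mat[OF Mk smult_carrier_mat[OF M]] mult_smult_distrib[OF Mk M])
  also have "\<dots> = c ^ Suc k \<cdot>\<^sub>m (M ^\<^sub>m k * M)"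
    by (rule eq_matI) auto
  finally show ?case using Suc.IH by simp
qed

text \<open>Choose \<open>r\<close> strictly between the spectral radius and 1. The matrix rescaled
  by \<open>1 / r\<close> still has spectral radius below 1, so its powers are bounded; undoing the
  scaling turns this bound into the rate \<open>r ^ k\<close>.\<close>

lemma schur_stable_geometric_decay:
  assumes M: "M \<in> carrier_mat n n" and n: "0 < n" and st: "schur_stable M"
  shows "\<exists>C r. 0 \<le> C \<and> 0 < r \<and> r < 1 \<and> (\<forall>k. \<forall>i<n. \<forall>j<n. \<bar>(M ^\<^sub>m k) $$ (i, j)\<bar> \<le> C * r ^ k)"
proof -
  let ?M = "map_mat complex_of_real M"
  have cM: "?M \<in> carrier_mat n n" using M by simp
  obtain r where r: "spectral_radius ?M < r" "r < 1"
    using st dense unfolding schur_stable_def by blast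
  \<comment> \<open>This makes \<open>r\<close> positive, as the scaling by \<open>1 / r\<close>
    requires.\<close>
  have "0 \<le> spectral_radius ?M"
    using spectral_radius_mem_max(1)[OF cM n] by auto
  with r have r0: "0 < r" by simp
  let ?S = "complex_of_real (1 / r) \<cdot>\<^sub>m ?M"
  have cS: "?S \<in> carrier_mat n n" using cM by simp
  have "spectral_radius ?S < 1"
    unfolding spectral_radius_less_iff[OF cS n]
  proof (intro allI impI)
    fix e assume "eigenvalue ?S e"
    from eigenvalue_smult[OF cM _ this] r0
    have "eigenvalue ?M (e * of_real r)" by simp
    with r(1) have "norm (e * of_real r) < r"
      unfolding spectral_radius_less_iff[OF cM n] by blast
    with r0 show "norm e < 1" by (simp add: norm_mult)
  qed
  from spectral_radius_jnf_norm_bound_less_1_upper_triangular[OF cS this]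
  obtain c where c: "\<And>k. norm_bound (?S ^\<^sub>m k) c" by blast
  have "\<bar>(M ^\<^sub>m k) $$ (i, j)\<bar> \<le> \<bar>c\<bar> * r ^ k" if "i < n" "j < n" for i j k
  proof -
    have "?S ^\<^sub>m k = complex_of_real (1 / r) ^ k \<cdot>\<^sub>m map_mat complex_of_real (M ^\<^sub>m k)"
      using pow_smult_mat[OF cM] by (simp add: of_real_hom.mat_hom_pow[OF M])
    then have "(?S ^\<^sub>m k) $$ (i, j) = complex_of_real ((1 / r) ^ k * (M ^\<^sub>m k) $$ (i, j))"
      using M that by simp
    moreover have "norm ((?S ^\<^sub>m k) $$ (i, j)) \<le> c"
      using c[of k] pow_carrier_mat[OF cS, of k] that unfolding norm_bound_def by (metis carrier_matD)
    ultimately have "(1 / r) ^ k * \<bar>(M ^\<^sub>m k) $$ (i, j)\<bar> \<le> c"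
      using r0 by (simp only: norm_of_real abs_mult) simp
    then have "\<bar>(M ^\<^sub>m k) $$ (i, j)\<bar> \<le> c * r ^ k"
      using r0 by (simp add: field_simps)
    \<comment> \<open>Passing to the absolute value makes the constant visibly nonnegative, as the
      statement demands of \<open>C\<close>.\<close>
    also have "\<dots> \<le> \<bar>c\<bar> * r ^ k"
      using r0 by (intro mult_right_mono) auto
    finally show ?thesis .
  qed
  then show ?thesis using r r0 by (intro exI[of _ "\<bar>c\<bar>"] exI[of _ r]) auto
qed

text \<open>Once \<open>a\<close> stays below \<open>d\<close>, the sequence is dominated by
  iterates of the affine contraction t -> r t + d, and the memory of earlier terms dies out
  geometrically.\<close>

lemma contraction_vanishing_input:
  fixes s a :: "nat \<Rightarrow> real"
  assumes s0: "\<And>k. 0 \<le> s k" and r: "0 \<le> r" "r < 1"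
    and rec: "\<And>k. s (Suc k) \<le> r * s k + a k" and a: "a \<longlonglongrightarrow> 0"
  shows "s \<longlonglongrightarrow> 0"
proof (rule LIMSEQ_I)
  fix e :: real assume e: "0 < e"
  \<comment> \<open>With this \<open>d\<close> the contraction t -> r t + d has the fixed point
    \<open>e / 2\<close>; the other half of \<open>e\<close> is left for the transient
    \<open>r ^ p * s K\<close>.\<close>
  define d where "d = e / 2 * (1 - r)"
  have "0 < d" using e r by (simp add: d_def)
  from LIMSEQ_D[OF a this] obtain K where K: "\<And>k. K \<le> k \<Longrightarrow> \<bar>a k\<bar> < d" by auto
  have bnd: "s (K + p) \<le> e / 2 + r ^ p * s K" for p
  proof (induction p)
    case 0
    then show ?case using e by simp
  next
    case (Suc p)
    have "s (K + Suc p) \<le> r * s (K + p) + d"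
      using rec[of "K + p"] K[of "K + p"] by simp
    also have "\<dots> \<le> r * (e / 2 + r ^ p * s K) + d"
      using Suc.IH r by (simp add: mult_left_mono)
    also have "\<dots> = e / 2 + r ^ Suc p * s K" by (simp add: d_def field_simps)
    finally show ?case .
  qed
  have "(\<lambda>p. r ^ p * s K) \<longlonglongrightarrow> 0"
    using LIMSEQ_realpow_zero[OF r] tendsto_mult_left_zero by blast
  from LIMSEQ_D[OF this, of "e / 2"] e obtain p0
    where p0: "\<And>p. p0 \<le> p \<Longrightarrow> \<bar>r ^ p * s K\<bar> < e / 2" by auto
  have "norm (s k - 0) < e" if "K + p0 \<le> k" for k
    proof -
    have k: "p0 \<le> k - K" "K + (k - K) = k" using that by simp_all
    show ?thesis using bnd[of "k - K"] p0[OF k(1)] s0[of k] unfolding k(2) by simp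
  qed
  then show "\<exists>k0. \<forall>k\<ge>k0. norm (s k - 0) < e" by blast
qed

section \<open>Entrywise convergence of vector sequences\<close>

text \<open>Convergence entry by entry needs only limits of real sequences and passes directly
  between a stacked vector and its blocks; \<open>vanishing_euclid_norm\<close> converts it to the
  norm at the end.\<close>

definition vanishing :: "nat \<Rightarrow> (nat \<Rightarrow> real vec) \<Rightarrow> bool" where
  "vanishing n f \<longleftrightarrow> (\<forall>j<n. (\<lambda>k. f k $ j) \<longlonglongrightarrow> 0)"

lemma vanishing_euclid_norm:
  assumes f: "\<And>k. f k \<in> carrier_vec n" and van: "vanishing n f"
  shows "(\<lambda>k. euclid_norm (f k)) \<longlonglongrightarrow> 0"
proof -
  have "(\<lambda>k. sqrt (\<Sum>j<n. f k $ j * f k $ j)) \<longlonglongrightarrow> sqrt (\<Sum>j<n. 0 * 0)"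
    using van unfolding vanishing_def by (intro tendsto_intros) auto
  moreover have "euclid_norm (f k) = sqrt (\<Sum>j<n. f k $ j * f k $ j)" for k
    using f[of k] by (auto simp: euclid_norm_def scalar_prod_def lessThan_atLeast0)
  ultimately show ?thesis by simp
qed

lemma vanishing_add:
  assumes "\<And>k. g k \<in> carrier_vec n" "vanishing n f" "vanishing n g"
  shows "vanishing n (\<lambda>k. f k + g k)"
  unfolding vanishing_def
proof (intro allI impI)
  fix j assume j: "j < n"
  then have "(\<lambda>k. f k $ j + g k $ j) \<longlonglongrightarrow> 0 + 0"
    using assms(2,3) unfolding vanishing_def by (intro tendsto_intros) auto
  moreover have "(f k + g k) $ j = f k $ j + g k $ j" for k using assms(1)[of k] j by simp
  ultimately show "(\<lambda>k. (f k + g k) $ j) \<longlonglongrightarrow> 0" by simp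
qed

lemma mult_mat_vec_index_sum:
  assumes "M \<in> carrier_mat p n" "v \<in> carrier_vec n" "i < p"
  shows "(M *\<^sub>v v) $ i = (\<Sum>j<n. M $$ (i, j) * v $ j)"
  using assms by (auto simp: scalar_prod_def lessThan_atLeast0)

lemma vanishing_mult_mat_vec:
  assumes M: "M \<in> carrier_mat p n" and f: "\<And>k. f k \<in> carrier_vec n" and van: "vanishing n f"
  shows "vanishing p (\<lambda>k. M *\<^sub>v f k)"
  unfolding vanishing_def
proof (intro allI impI)
  fix i assume i: "i < p"
  have "(\<lambda>k. \<Sum>j<n. M $$ (i, j) * f k $ j) \<longlonglongrightarrow> (\<Sum>j<n. M $$ (i, j) * 0)"
    using van unfolding vanishing_def by (intro tendsto_intros) auto
  then show "(\<lambda>k. (M *\<^sub>v f k) $ i) \<longlonglongrightarrow> 0"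
    using mult_mat_vec_index_sum[OF M f i] by simp
qed

text \<open>Powers of \<open>M\<close> contract only up to the factor \<open>C\<close>, so a fixed
  norm of \<open>v k\<close> need not decrease in every step. A scalar majorant \<open>s\<close>
  takes its place: it tends to 0 by \<open>contraction_vanishing_input\<close> and dominates every
  entry of \<open>v k\<close>.\<close>

lemma schur_stable_vanishing_input:
  assumes M: "M \<in> carrier_mat n n" and n: "0 < n" and st: "schur_stable M"
    and v: "\<And>k. v k \<in> carrier_vec n" and d: "\<And>k. d k \<in> carrier_vec n"
    and rec: "\<And>k. v (Suc k) = M *\<^sub>v v k + d k" and van: "vanishing n d"
  shows "vanishing n v"
proof -
  from schur_stable_geometric_decay[OF M n st] obtain C r
    where C: "0 \<le> C" and r: "0 < r" "r < 1"
      and bnd: "\<And>k i j. i < n \<Longrightarrow> j < n \<Longrightarrow> \<bar>(M ^\<^sub>m k) $$ (i, j)\<bar> \<le> C * r ^ k" by blast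
  define l1 where "l1 w = (\<Sum>j<n. \<bar>w $ j\<bar>)" for w :: "real vec"
  have Mp: "M ^\<^sub>m p \<in> carrier_mat n n" for p using M by simp
  have pow: "\<bar>(M ^\<^sub>m p *\<^sub>v w) $ i\<bar> \<le> r ^ p * (C * l1 w)"
    if "w \<in> carrier_vec n" "i < n" for p w i
  proof -
    have "\<bar>(M ^\<^sub>m p *\<^sub>v w) $ i\<bar> \<le> (\<Sum>j<n. \<bar>(M ^\<^sub>m p) $$ (i, j) * w $ j\<bar>)"
      unfolding mult_mat_vec_index_sum[OF Mp that] by (rule sum_abs)
    also have "\<dots> \<le> (\<Sum>j<n. (C * r ^ p) * \<bar>w $ j\<bar>)"
      using bnd that by (intro sum_mono) (simp add: abs_mult mult_right_mono)
    finally show ?thesis by (simp add: l1_def sum_distrib_left mult_ac)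
  qed
  \<comment> \<open>Each contribution to the state, be it \<open>v 0\<close> or an input
    \<open>d k\<close>, pays the factor \<open>C\<close> once on entering and is then damped by
    \<open>r\<close> in every step.\<close>
  define s where "s = rec_nat (C * l1 (v 0)) (\<lambda>k t. r * t + C * l1 (d k))"
  have s: "s 0 = C * l1 (v 0)" "s (Suc k) = r * s k + C * l1 (d k)" for k
    by (simp_all add: s_def)
  have l1: "0 \<le> l1 w" for w by (simp add: l1_def sum_nonneg)
  have s0: "0 \<le> s k" for k
    by (induction k) (use C r l1 in \<open>simp_all add: s\<close>)
  have "(\<lambda>k. C * l1 (d k)) \<longlonglongrightarrow> C * (\<Sum>j<n. \<bar>0\<bar>)"
    using van unfolding vanishing_def l1_def by (intro tendsto_intros) auto
  then have s_lim: "s \<longlonglongrightarrow> 0"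
    using contraction_vanishing_input[of s r "\<lambda>k. C * l1 (d k)"] s0 r s by simp
  \<comment> \<open>Quantifying over all powers \<open>p\<close> makes the bound inductive without an adapted norm.\<close>
  have main: "\<bar>(M ^\<^sub>m p *\<^sub>v v k) $ i\<bar> \<le> r ^ p * s k" if "i < n" for p k i
  proof (induction k arbitrary: p)
    case 0
    then show ?case using pow[OF v that] by (simp add: s)
  next
    case (Suc k)
    have "M ^\<^sub>m p *\<^sub>v v (Suc k) = M ^\<^sub>m Suc p *\<^sub>v v k + M ^\<^sub>m p *\<^sub>v d k"
      using M Mp[of p] v d by (simp add: rec mult_add_distrib_mat_vec[of _ n n] assoc_mult_mat_vec[of _ n n _ n])
    then have "\<bar>(M ^\<^sub>m p *\<^sub>v v (Suc k)) $ i\<bar> \<le> \<bar>(M ^\<^sub>m Suc p *\<^sub>v v k) $ i\<bar> + \<bar>(M ^\<^sub>m p *\<^sub>v d k) $ i\<bar>"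
      using carrier_matD[OF Mp[of p]] that by (simp del: pow_mat.simps)
    also have "\<dots> \<le> r ^ Suc p * s k + r ^ p * (C * l1 (d k))"
      by (intro add_mono Suc.IH pow d that)
    finally show ?case by (simp add: s algebra_simps)
  qed
  have "\<bar>v k $ i\<bar> \<le> s k" if "i < n" for k i
    using main[OF that, of 0 k] M v[of k] by simp
  then show ?thesis
    unfolding vanishing_def using s0
    by (intro allI impI, intro tendsto_0_le[OF s_lim, of _ 1]) simp
qed

section \<open>Block vectors and block matrices\<close>

text \<open>An index below \<open>q * c\<close> is split into block number and offset. Blocks are
  counted from 1 and offsets from 0, hence the \<open>l - 1\<close>. The product formulas for block
  vectors and block matrices reduce to this splitting.\<close>

lemma sum_blocks:
  fixes g :: "nat \<Rightarrow> 'a :: comm_monoid_add"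
  shows "(\<Sum>b<q * c. g b) = (\<Sum>l\<in>{1..q}. \<Sum>b<c. g ((l - 1) * c + b))"
proof -
  have "(\<Sum>b\<in>{l * c..<l * c + c}. g b) = (\<Sum>b<c. g (l * c + b))" for l
    using sum.shift_bounds_nat_ivl[of g 0 "l * c" c]
    by (simp add: add.commute lessThan_atLeast0)
  then have "(\<Sum>b<q * c. g b) = (\<Sum>l<q. \<Sum>b<c. g (l * c + b))"
    by (simp flip: sum.nat_group)
  also have "\<dots> = (\<Sum>l\<in>{1..q}. \<Sum>b<c. g ((l - 1) * c + b))"
    by (rule sum.reindex_bij_witness[of _ "\<lambda>l. l - 1" Suc]) auto
  finally show ?thesis .
qed

lemma block_index_less:
  fixes a b r p :: nat
  assumes "i \<in> {1..p}" "a < r"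
  shows "(i - 1) * r + a < p * r"
proof -
  have "(i - 1) * r + a < (i - 1) * r + r" using assms by simp
  also have "\<dots> = i * r" using assms by (cases i) auto
  also have "\<dots> \<le> p * r" using assms by simp
  finally show ?thesis .
qed

lemma block_of_index:
  fixes a p r :: nat
  assumes "a < p * r"
  shows "Suc (a div r) \<in> {1..p}" "a mod r < r"
proof -
  \<comment> \<open>The bound on \<open>a\<close> excludes \<open>r = 0\<close>, for which
    \<open>a mod r\<close> would not be an offset below \<open>r\<close>.\<close>
  have "0 < r" using assms by (cases r) auto
  then show "Suc (a div r) \<in> {1..p}" "a mod r < r"
    using assms by (simp_all add: less_mult_imp_div_less Suc_le_eq)
qed

lemma block_vec_carrier [simp]: "block_vec p r v \<in> carrier_vec (p * r)"
  by (simp add: block_vec_def)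

lemma dim_block_vec [simp]: "dim_vec (block_vec p r v) = p * r"
  by (simp add: block_vec_def)

lemma block_vec_index:
  "a < p * r \<Longrightarrow> block_vec p r v $ a = v (Suc (a div r)) $ (a mod r)"
  by (simp add: block_vec_def)

lemma block_vec_index_block:
  assumes "i \<in> {1..p}" "a < r"
  shows "block_vec p r v $ ((i - 1) * r + a) = v i $ a"
  using assms block_index_less[OF assms] by (simp add: block_vec_index)

lemma block_vec_add:
  assumes w: "\<And>i. i \<in> {1..p} \<Longrightarrow> w i \<in> carrier_vec r"
  shows "block_vec p r v + block_vec p r w = block_vec p r (\<lambda>i. v i + w i)"
proof (rule eq_vecI)
  fix k assume "k < dim_vec (block_vec p r (\<lambda>i. v i + w i))"
  then have k: "k < p * r" by simp
  show "(block_vec p r v + block_vec p r w) $ k = block_vec p r (\<lambda>i. v i + w i) $ k"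
    using k block_of_index(2)[OF k] carrier_vecD[OF w[OF block_of_index(1)[OF k]]]
    by (simp add: block_vec_index)
qed simp

lemma block_vec_cong:
  assumes "\<And>i. i \<in> {1..p} \<Longrightarrow> v i = w i"
  shows "block_vec p r v = block_vec p r w"
  using assms block_of_index by (intro eq_vecI) (auto simp: block_vec_index)

text \<open>Inverse to \<open>block_vec\<close>, but polymorphic in the entries, since complex
  eigenvectors have to be cut into blocks as well.\<close>

definition vec_block :: "nat \<Rightarrow> 'a vec \<Rightarrow> nat \<Rightarrow> 'a vec" where
  "vec_block r v i = vec r (\<lambda>a. v $ ((i - 1) * r + a))"

lemma vec_block_carrier [simp]: "vec_block r v i \<in> carrier_vec r"
  by (simp add: vec_block_def)

lemma block_vec_vec_block:
  assumes "v \<in> carrier_vec (p * r)"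
  shows "block_vec p r (vec_block r v) = v"
  using assms block_of_index
  by (intro eq_vecI) (auto simp: block_vec_index vec_block_def)

lemma block_mat_carrier [simp]: "block_mat p q r c F \<in> carrier_mat (p * r) (q * c)"
  by (simp add: block_mat_def)

lemma block_mat_index:
  assumes "i \<in> {1..p}" "l \<in> {1..q}" "a < r" "b < c"
  shows "block_mat p q r c F $$ ((i - 1) * r + a, (l - 1) * c + b) = F i l $$ (a, b)"
  using assms block_index_less[OF assms(1,3)] block_index_less[OF assms(2,4)]
  by (simp add: block_mat_def)

lemma block_mat_mult_block_vec:
  assumes F: "\<And>i l. i \<in> {1..p} \<Longrightarrow> l \<in> {1..q} \<Longrightarrow> F i l \<in> carrier_mat r c"
    and v: "\<And>l. l \<in> {1..q} \<Longrightarrow> v l \<in> carrier_vec c"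
    and i: "i \<in> {1..p}" and a: "a < r"
  shows "(block_mat p q r c F *\<^sub>v block_vec q c v) $ ((i - 1) * r + a) = (\<Sum>l\<in>{1..q}. (F i l *\<^sub>v v l) $ a)"
proof -
  let ?a = "(i - 1) * r + a"
  have "(block_mat p q r c F *\<^sub>v block_vec q c v) $ ?a
      = (\<Sum>b<q * c. block_mat p q r c F $$ (?a, b) * block_vec q c v $ b)"
    by (rule mult_mat_vec_index_sum[OF block_mat_carrier block_vec_carrier block_index_less[OF i a]])
  also have "\<dots> = (\<Sum>l\<in>{1..q}. \<Sum>b<c. F i l $$ (a, b) * v l $ b)"
    unfolding sum_blocks
    by (intro sum.cong refl arg_cong2[where f = "(*)"] block_mat_index block_vec_index_block i a) simp_all
  also have "\<dots> = (\<Sum>l\<in>{1..q}. (F i l *\<^sub>v v l) $ a)"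
    by (intro sum.cong refl) (simp add: mult_mat_vec_index_sum[OF F[OF i] v a])
  finally show ?thesis .
qed

section \<open>Block diagonal matrices\<close>

text \<open>Peeling off the head block lowers the remaining row and column indices by
  \<open>r\<close> and \<open>c\<close>: block numbers drop by one and offsets stay, so the closed
  formula survives the recursion.\<close>

lemma diag_block_mat_eq_mat:
  assumes "\<And>M. M \<in> set Ms \<Longrightarrow> M \<in> carrier_mat r c"
  shows "diag_block_mat Ms = mat (length Ms * r) (length Ms * c)
    (\<lambda>(a, b). if a div r = b div c then Ms ! (a div r) $$ (a mod r, b mod c) else 0)"
  using assms
proof (induction Ms)
  case Nil
  then show ?case by (intro eq_matI) auto
next
  case (Cons M Ms)
  have M: "M \<in> carrier_mat r c" using Cons.prems by simp
  let ?D = "mat (length Ms * r) (length Ms * c)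
    (\<lambda>(a, b). if a div r = b div c then Ms ! (a div r) $$ (a mod r, b mod c) else 0)"
  have IH: "diag_block_mat Ms = ?D" using Cons.IH Cons.prems by simp
  have split: "k div d = Suc ((k - d) div d)" "k mod d = (k - d) mod d" if "0 < d" "\<not> k < d" for k d :: nat
    using that by (simp_all add: le_div_geq le_mod_geq)
  show ?case
  proof (rule eq_matI, goal_cases)
    case (1 a b)
    then have ab: "a < length (M # Ms) * r" "b < length (M # Ms) * c" by simp_all
    \<comment> \<open>An existing entry forces nonempty blocks, so that \<open>div\<close> and
      \<open>mod\<close> behave as intended.\<close>
    then have pos: "0 < r" "0 < c" by (auto intro: gr0I)
    show ?case
      using ab pos M carrier_matD[OF M]
      by (cases "a < r"; cases "b < c") (auto simp: Let_def IH split)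
  next
    case 2
    show ?case using M by (simp add: Let_def IH)
  next
    case 3
    show ?case using M by (simp add: Let_def IH)
  qed
qed

text \<open>The list is indexed from 0 and the blocks from 1; they match because entry
  \<open>a div r\<close> of \<open>map F [1..<Suc p]\<close> is
  \<open>F (Suc (a div r))\<close>.\<close>

lemma block_diag_eq_block_mat:
  assumes F: "\<And>i. i \<in> {1..p} \<Longrightarrow> F i \<in> carrier_mat r c"
  shows "block_diag p F = block_mat p p r c (\<lambda>i l. if i = l then F i else 0\<^sub>m r c)"
proof -
  have "block_diag p F = mat (p * r) (p * c)
    (\<lambda>(a, b). if a div r = b div c then map F [1..<Suc p] ! (a div r) $$ (a mod r, b mod c) else 0)"
    unfolding block_diag_def by (subst diag_block_mat_eq_mat[of _ r c]) (use F in \<open>auto simp del: upt_Suc\<close>)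
  also have "\<dots> = block_mat p p r c (\<lambda>i l. if i = l then F i else 0\<^sub>m r c)"
    unfolding block_mat_def
  proof (rule cong_mat, goal_cases)
    case (3 a b)
    then show ?case
      using block_of_index[OF 3(1)] block_of_index[OF 3(2)] by (auto simp del: upt_Suc)
  qed auto
  finally show ?thesis .
qed

lemma block_diag_carrier:
  assumes "\<And>i. i \<in> {1..p} \<Longrightarrow> F i \<in> carrier_mat r c"
  shows "block_diag p F \<in> carrier_mat (p * r) (p * c)"
  using block_diag_eq_block_mat[OF assms] by simp

lemma block_vec_eqI:
  assumes v: "v \<in> carrier_vec (p * r)"
    and "\<And>i a. i \<in> {1..p} \<Longrightarrow> a < r \<Longrightarrow> v $ ((i - 1) * r + a) = w i $ a"
  shows "v = block_vec p r w"
proof (rule eq_vecI)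
  fix k assume "k < dim_vec (block_vec p r w)"
  then have k: "k < p * r" by simp
  show "v $ k = block_vec p r w $ k"
    using assms(2)[OF block_of_index[OF k]] by (simp add: block_vec_index[OF k])
qed (use v in auto)

lemma block_diag_mult_block_vec:
  assumes F: "\<And>i. i \<in> {1..p} \<Longrightarrow> F i \<in> carrier_mat r c"
    and v: "\<And>i. i \<in> {1..p} \<Longrightarrow> v i \<in> carrier_vec c"
  shows "block_diag p F *\<^sub>v block_vec p c v = block_vec p r (\<lambda>i. F i *\<^sub>v v i)"
proof (rule block_vec_eqI)
  show "block_diag p F *\<^sub>v block_vec p c v \<in> carrier_vec (p * r)"
    using block_diag_carrier[of p F, OF F] by (meson block_vec_carrier mult_mat_vec_carrier)
next
  fix i a assume i: "i \<in> {1..p}" and a: "a < r"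
  let ?F = "\<lambda>i l. if i = l then F i else 0\<^sub>m r c"
  have zero: "(0\<^sub>m r c *\<^sub>v w) $ a = 0" if "w \<in> carrier_vec c" for w :: "real vec"
    using that a by simp
  have "(block_diag p F *\<^sub>v block_vec p c v) $ ((i - 1) * r + a) = (\<Sum>l\<in>{1..p}. (?F i l *\<^sub>v v l) $ a)"
    using F by (subst block_diag_eq_block_mat[of p F r c])
      (auto intro!: block_mat_mult_block_vec[OF _ v i a, simplified])
  also have "\<dots> = (\<Sum>l\<in>{1..p}. if l = i then (F i *\<^sub>v v i) $ a else 0)"
    using zero v by (intro sum.cong) auto
  also have "\<dots> = (F i *\<^sub>v v i) $ a" using i by simp
  finally show "(block_diag p F *\<^sub>v block_vec p c v) $ ((i - 1) * r + a) = (F i *\<^sub>v v i) $ a" .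
qed

lemma block_diag_transpose:
  assumes F: "\<And>i. i \<in> {1..p} \<Longrightarrow> F i \<in> carrier_mat r c"
  shows "(block_diag p F)\<^sup>T = block_diag p (\<lambda>i. (F i)\<^sup>T)"
proof -
  have T: "(F i)\<^sup>T \<in> carrier_mat c r" if "i \<in> {1..p}" for i using F[OF that] by simp
  have eqs: "block_diag p F = block_mat p p r c (\<lambda>i l. if i = l then F i else 0\<^sub>m r c)"
    "block_diag p (\<lambda>i. (F i)\<^sup>T) = block_mat p p c r (\<lambda>i l. if i = l then (F i)\<^sup>T else 0\<^sub>m c r)"
    using F T by (intro block_diag_eq_block_mat; blast)+
  show ?thesis
    unfolding eqs
  proof (rule eq_matI, goal_cases)
    case (1 a b)
    then have "a < p * c" "b < p * r" by (simp_all add: block_mat_def)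
    with block_of_index[OF this(1)] block_of_index[OF this(2)] F[of "Suc (a div c)"] show ?case
      by (auto simp: block_mat_def)
  qed (simp_all add: block_mat_def)
qed

lemma scalar_prod_block_vec:
  assumes "\<And>i. i \<in> {1..p} \<Longrightarrow> w i \<in> carrier_vec r"
  shows "block_vec p r v \<bullet> block_vec p r w = (\<Sum>i\<in>{1..p}. v i \<bullet> w i)"
proof -
  have "block_vec p r v \<bullet> block_vec p r w = (\<Sum>a<p * r. block_vec p r v $ a * block_vec p r w $ a)"
    by (simp add: scalar_prod_def lessThan_atLeast0)
  also have "\<dots> = (\<Sum>i\<in>{1..p}. \<Sum>a<r. v i $ a * w i $ a)"
    unfolding sum_blocks
    by (intro sum.cong refl arg_cong2[where f = "(*)"] block_vec_index_block) simp_all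
  also have "\<dots> = (\<Sum>i\<in>{1..p}. v i \<bullet> w i)"
    using carrier_vecD[OF assms]
    by (intro sum.cong) (simp_all only: scalar_prod_def lessThan_atLeast0)
  finally show ?thesis .
qed

section \<open>Block columns and block rows\<close>

lemma block_col_carrier: "M \<in> carrier_mat d c \<Longrightarrow> block_col m M i \<in> carrier_mat d m"
  by (auto simp: block_col_def)

lemma block_row_carrier: "M \<in> carrier_mat r d \<Longrightarrow> block_row m M i \<in> carrier_mat m d"
  by (auto simp: block_row_def)

text \<open>Splits the global input term into the contributions of the single agents, the form in
  which it appears in the observers.\<close>

lemma mult_block_vec_block_cols:
  assumes M: "M \<in> carrier_mat d (p * m)" and a: "a < d"
    and w: "\<And>i. i \<in> {1..p} \<Longrightarrow> w i \<in> carrier_vec m"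
  shows "(M *\<^sub>v block_vec p m w) $ a = (\<Sum>i\<in>{1..p}. (block_col m M i *\<^sub>v w i) $ a)"
proof -
  have "(M *\<^sub>v block_vec p m w) $ a = (\<Sum>i\<in>{1..p}. \<Sum>b<m. M $$ (a, (i - 1) * m + b) * w i $ b)"
    unfolding mult_mat_vec_index_sum[OF M block_vec_carrier a] sum_blocks
    by (intro sum.cong refl arg_cong2[where f = "(*)"] block_vec_index_block) simp_all
  also have "\<dots> = (\<Sum>i\<in>{1..p}. (block_col m M i *\<^sub>v w i) $ a)"
  proof (intro sum.cong refl)
    fix i assume i: "i \<in> {1..p}"
    show "(\<Sum>b<m. M $$ (a, (i - 1) * m + b) * w i $ b) = (block_col m M i *\<^sub>v w i) $ a"
      unfolding mult_mat_vec_index_sum[OF block_col_carrier[OF M] w[OF i] a]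
      using M a by (simp add: block_col_def)
  qed
  finally show ?thesis .
qed

text \<open>If all agents apply their block rows to one common vector, together they realize the
  undivided feedback \<open>M\<close>.\<close>

lemma mult_mat_vec_block_rows:
  assumes M: "M \<in> carrier_mat (p * m) d" and v: "v \<in> carrier_vec d"
  shows "M *\<^sub>v v = block_vec p m (\<lambda>i. block_row m M i *\<^sub>v v)"
proof (rule block_vec_eqI)
  show "M *\<^sub>v v \<in> carrier_vec (p * m)" using M v by simp
next
  fix i a assume i: "i \<in> {1..p}" and a: "a < m"
  note less = block_index_less[OF i a]
  show "(M *\<^sub>v v) $ ((i - 1) * m + a) = (block_row m M i *\<^sub>v v) $ a"
    unfolding mult_mat_vec_index_sum[OF M v less] mult_mat_vec_index_sum[OF block_row_carrier[OF M] v a]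
    using M a by (simp add: block_row_def)
qed

lemma vanishing_block_vecD:
  assumes van: "vanishing (p * r) (\<lambda>k. block_vec p r (\<lambda>i. v i k))" and i: "i \<in> {1..p}"
  shows "vanishing r (v i)"
  unfolding vanishing_def
proof (intro allI impI)
  fix a assume a: "a < r"
  from van block_index_less[OF i a]
  have "(\<lambda>k. block_vec p r (\<lambda>i. v i k) $ ((i - 1) * r + a)) \<longlonglongrightarrow> 0"
    unfolding vanishing_def by blast
  then show "(\<lambda>k. v i k $ a) \<longlonglongrightarrow> 0"
    unfolding block_vec_index_block[OF i a] .
qed

lemma vanishing_block_vecI:
  assumes "\<And>i. i \<in> {1..p} \<Longrightarrow> vanishing r (v i)"
  shows "vanishing (p * r) (\<lambda>k. block_vec p r (\<lambda>i. v i k))"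
  using assms block_of_index unfolding vanishing_def by (simp add: block_vec_index)

section \<open>The Riccati closed loop\<close>

lemma scalar_prod_self_nonneg: "0 \<le> v \<bullet> v" for v :: "real vec"
  by (simp add: scalar_prod_def sum_nonneg)

lemma scalar_prod_self_eq_0:
  fixes v :: "real vec"
  assumes "v \<in> carrier_vec n" "v \<bullet> v = 0"
  shows "v = 0\<^sub>v n"
  using assms by (intro eq_vecI) (auto simp: scalar_prod_def sum_nonneg_eq_0_iff)

text \<open>With y = Q x, the form at x + t y equals 2 t |y|^2 + t^2 (y . Q y). It is nonnegative
  for every real t, but its linear term would dominate for small negative t unless y = 0.\<close>

lemma semidef_kernel:
  assumes Q: "sym_pos_semidef n Q" and x: "x \<in> carrier_vec n" and 0: "x \<bullet> (Q *\<^sub>v x) = 0"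
  shows "Q *\<^sub>v x = 0\<^sub>v n"
proof -
  have Qc: "Q \<in> carrier_mat n n" and sym: "Q\<^sup>T = Q"
    and pos: "\<And>v. v \<in> carrier_vec n \<Longrightarrow> 0 \<le> v \<bullet> (Q *\<^sub>v v)"
    using Q by (auto simp: sym_pos_semidef_def)
  let ?y = "Q *\<^sub>v x"
  define b c where "b = ?y \<bullet> ?y" and "c = ?y \<bullet> (Q *\<^sub>v ?y)"
  have y: "?y \<in> carrier_vec n" using Qc x by simp
  have xQy: "x \<bullet> (Q *\<^sub>v ?y) = b"
    using transpose_vec_mult_scalar[OF Qc y x] by (simp add: sym b_def)
  have quad: "0 \<le> 2 * t * b + t\<^sup>2 * c" for t
  proof -
    have ty: "t \<cdot>\<^sub>v ?y \<in> carrier_vec n" using y by simp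
    have Qty: "Q *\<^sub>v (t \<cdot>\<^sub>v ?y) = t \<cdot>\<^sub>v (Q *\<^sub>v ?y)" using Qc y by (simp add: mult_mat_vec)
    have Qy: "Q *\<^sub>v ?y \<in> carrier_vec n" using Qc y by simp
    have "(x + t \<cdot>\<^sub>v ?y) \<bullet> (Q *\<^sub>v (x + t \<cdot>\<^sub>v ?y))
        = x \<bullet> ?y + t * b + t * b + t * (t * c)"
      unfolding mult_add_distrib_mat_vec[OF Qc x ty] Qty b_def c_def xQy[symmetric]
      using x y Qy by (simp add: scalar_prod_add_distrib[of _ n] add_scalar_prod_distrib[of _ n] xQy b_def algebra_simps)
    with pos[of "x + t \<cdot>\<^sub>v ?y"] x y 0 show ?thesis by (simp add: power2_eq_square algebra_simps)
  qed
  have b: "0 \<le> b" by (simp add: b_def scalar_prod_self_nonneg)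
  have c: "0 \<le> c" using pos[OF y] by (simp add: c_def)
  have "b = 0"
  proof (rule ccontr)
    assume "b \<noteq> 0"
    with b have b: "0 < b" by simp
    \<comment> \<open>At \<open>- t\<close> the form becomes \<open>- (t\<^sup>2 * (c + 2))\<close>,
      which is negative; the denominator \<open>c + 1\<close> also covers
      \<open>c = 0\<close>.\<close>
    define t where "t = b / (c + 1)"
    have t: "b = t * (c + 1)" "0 < t" using b c by (simp_all add: t_def)
    have "0 \<le> 2 * (- t) * b + (- t)\<^sup>2 * c" by (rule quad)
    also have "\<dots> = - (t\<^sup>2 * (c + 2))" by (simp add: t(1) power2_eq_square algebra_simps)
    also have "\<dots> < 0" using t(2) c by (simp add: zero_less_mult_iff)
    finally show False by simp
  qed
  then show ?thesis using scalar_prod_self_eq_0[OF y] by (simp add: b_def)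
qed

text \<open>Invertibility makes \<open>S\<close> a unit of the matrix ring, so
  \<open>mat_inverse\<close> does not return \<open>None\<close> and the \<open>the\<close> in
  \<open>inv_mat\<close> is well defined.\<close>

lemma inv_mat_inverse:
  assumes S: "S \<in> carrier_mat n n" and inv: "invertible_mat S"
  shows "inv_mat S \<in> carrier_mat n n" "S * inv_mat S = 1\<^sub>m n"
proof -
  from inv obtain T where T: "S * T = 1\<^sub>m n" "T * S = 1\<^sub>m (dim_row T)"
    using S unfolding invertible_mat_def inverts_mat_def by auto
  have Tc: "T \<in> carrier_mat n n"
    using T S by (metis carrier_matD carrier_matI index_mult_mat(2,3) index_one_mat(2,3))
  have "S \<in> Units (ring_mat TYPE(real) n ())"
    using S T Tc unfolding Units_def ring_mat_def by auto
  then obtain U where U: "mat_inverse S = Some U"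
    using mat_inverse(1)[OF S, of "()"] by (cases "mat_inverse S") auto
  from mat_inverse(2)[OF S this] U
  show "inv_mat S \<in> carrier_mat n n" "S * inv_mat S = 1\<^sub>m n" by (simp_all add: inv_mat_def)
qed

text \<open>Put S = R + B^T P B and W = B^T P A, so that S K = - W. Then B^T P (A + B K) = W + (S -
  R) K = - R K, while the last term of the Riccati equation is - A^T P B K, which gives the identity
  for A^T.\<close>

lemma riccati_closed_loop:
  assumes A: "A \<in> carrier_mat d d" and B: "B \<in> carrier_mat d e"
    and Q: "Q \<in> carrier_mat d d" and R: "R \<in> carrier_mat e e"
    and P: "P \<in> carrier_mat d d"
    and inv: "invertible_mat (R + B\<^sup>T * P * B)"
    and ric: "riccati_solution A B Q R P"
    and K: "K = riccati_gain A B R P"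
  shows "K \<in> carrier_mat e d"
    and "A\<^sup>T * (P * (A + B * K)) = P - Q"
    and "B\<^sup>T * (P * (A + B * K)) = - (R * K)"
proof -
  define S where "S = R + B\<^sup>T * P * B"
  define X where "X = inv_mat S"
  define W where "W = B\<^sup>T * (P * A)"
  have T: "A\<^sup>T \<in> carrier_mat d d" "B\<^sup>T \<in> carrier_mat e d" using A B by auto
  have S: "S \<in> carrier_mat e e" unfolding S_def using R P B T by auto
  have X: "X \<in> carrier_mat e e" "S * X = 1\<^sub>m e"
    using inv_mat_inverse[OF S] inv by (simp_all add: X_def S_def)
  have PA: "P * A \<in> carrier_mat d d" using P A by simp
  have W: "W \<in> carrier_mat e d" unfolding W_def using T PA by auto
  have XBT: "X * B\<^sup>T \<in> carrier_mat e d" using X T by auto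
  have KX: "K = - (X * W)"
  proof -
    have "X * B\<^sup>T * P * A = X * W"
      unfolding W_def using X T P A XBT PA
      by (simp add: assoc_mult_mat[of _ e d _ d _ d] assoc_mult_mat[of _ e e _ d _ d])
    then show ?thesis unfolding K riccati_gain_def X_def S_def by simp
  qed
  show Kc: "K \<in> carrier_mat e d" unfolding KX using X W by simp
  have BK: "B * K \<in> carrier_mat d d" using B Kc by auto
  have PBK: "P * (B * K) \<in> carrier_mat d d" using P BK by auto
  have PM: "P * (A + B * K) = P * A + P * (B * K)"
    using P A BK by (rule mult_add_distrib_mat)
  have BB: "B\<^sup>T * P * B \<in> carrier_mat e e" using B T P by auto
  have SK: "S * K = - W"
    unfolding KX using S X W by (simp flip: assoc_mult_mat)
  have "B\<^sup>T * (P * (A + B * K)) = W + B\<^sup>T * (P * (B * K))"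
    unfolding PM W_def using T PA PBK by (intro mult_add_distrib_mat)
  also have "B\<^sup>T * (P * (B * K)) = B\<^sup>T * P * B * K"
  proof -
    have "B\<^sup>T * P * B * K = B\<^sup>T * P * (B * K)"
      using T P B Kc by (intro assoc_mult_mat[of _ e d _ e _ d]) auto
    also have "\<dots> = B\<^sup>T * (P * (B * K))"
      using T P BK by (intro assoc_mult_mat) auto
    finally show ?thesis by simp
  qed
  also have "\<dots> = S * K - R * K"
    unfolding S_def add_mult_distrib_mat[OF R BB Kc]
    using R BB Kc by (intro eq_matI) auto
  also have "W + (S * K - R * K) = - (R * K)"
    unfolding SK using W R Kc by (intro eq_matI) auto
  finally show "B\<^sup>T * (P * (A + B * K)) = - (R * K)" .
  have PB: "P * B \<in> carrier_mat d e" using P B by auto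
  have "A\<^sup>T * P * B * X * B\<^sup>T * P * A = A\<^sup>T * P * B * (X * W)"
  proof -
    have AB: "A\<^sup>T * P * B \<in> carrier_mat d e" using T P B by auto
    have "A\<^sup>T * P * B * X * B\<^sup>T * P * A = A\<^sup>T * P * B * X * B\<^sup>T * (P * A)"
      using AB X T P A by (intro assoc_mult_mat[of _ d d _ d _ d]) auto
    also have "\<dots> = A\<^sup>T * P * B * X * W"
      unfolding W_def using AB X T PA by (intro assoc_mult_mat[of _ d e _ d _ d]) auto
    also have "\<dots> = A\<^sup>T * P * B * (X * W)"
      using AB X W by (intro assoc_mult_mat) auto
    finally show ?thesis .
  qed
  also have "\<dots> = A\<^sup>T * P * (B * (X * W))"
    using T P B X W by (intro assoc_mult_mat[of _ d d _ e _ d]) auto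
  also have "\<dots> = A\<^sup>T * (P * (B * (X * W)))"
    using T P B X W by (intro assoc_mult_mat[of _ d d _ d _ d]) auto
  also have "\<dots> = - (A\<^sup>T * (P * (B * K)))"
    unfolding KX using T P B X W by simp
  \<comment> \<open>The Riccati equation subtracts the term just identified as - A^T P B K, which
    explains the double sign.\<close>
  finally have "P = A\<^sup>T * (P * A) + Q - - (A\<^sup>T * (P * (B * K)))"
    using ric T P A unfolding riccati_solution_def S_def[symmetric] X_def[symmetric]
    by (simp add: assoc_mult_mat[of _ d d _ d _ d])
  moreover have "A\<^sup>T * (P * (A + B * K)) = A\<^sup>T * (P * A) + A\<^sup>T * (P * (B * K))"
    unfolding PM using T PA PBK by (intro mult_add_distrib_mat)
  moreover have "A\<^sup>T * (P * A) \<in> carrier_mat d d" "A\<^sup>T * (P * (B * K)) \<in> carrier_mat d d"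
    using T PA PBK by auto
  moreover have "X + Y = X + Q - - Y - Q" if "X \<in> carrier_mat d d" "Y \<in> carrier_mat d d" for X Y
    using that Q by (intro eq_matI) auto
  ultimately show "A\<^sup>T * (P * (A + B * K)) = P - Q" by metis
qed

text \<open>Only the left factor of y . P y is expanded, as A x + B (K x); the right one stays P (A
  + B K) x. Moving A and B across the product then produces exactly the left-hand sides of
  \<open>AP\<close> and \<open>BP\<close>.\<close>

lemma riccati_lyapunov:
  fixes A B K Q R P :: "real mat"
  assumes A: "A \<in> carrier_mat d d" and B: "B \<in> carrier_mat d e" and K: "K \<in> carrier_mat e d"
    and Q: "Q \<in> carrier_mat d d" and R: "R \<in> carrier_mat e e" and P: "P \<in> carrier_mat d d"
    and AP: "A\<^sup>T * (P * (A + B * K)) = P - Q" and BP: "B\<^sup>T * (P * (A + B * K)) = - (R * K)"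
    and x: "x \<in> carrier_vec d"
  defines "y \<equiv> (A + B * K) *\<^sub>v x"
  shows "y \<bullet> (P *\<^sub>v y) = x \<bullet> (P *\<^sub>v x) - x \<bullet> (Q *\<^sub>v x) - (K *\<^sub>v x) \<bullet> (R *\<^sub>v (K *\<^sub>v x))"
proof -
  have BK: "B * K \<in> carrier_mat d d" using B K by auto
  have M: "A + B * K \<in> carrier_mat d d" using A BK by auto
  have PM: "P * (A + B * K) \<in> carrier_mat d d" using P M by auto
  have Kx: "K *\<^sub>v x \<in> carrier_vec e" using K x by auto
  have Py: "P *\<^sub>v y = P * (A + B * K) *\<^sub>v x" unfolding y_def using P M x by simp
  have Pyc: "P *\<^sub>v y \<in> carrier_vec d" unfolding Py using PM x by auto
  have y: "y = A *\<^sub>v x + B *\<^sub>v (K *\<^sub>v x)"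
    unfolding y_def using A B K BK x by (simp add: add_mult_distrib_mat_vec[of _ d d])
  have 1: "(A *\<^sub>v x) \<bullet> (P *\<^sub>v y) = x \<bullet> (P *\<^sub>v x) - x \<bullet> (Q *\<^sub>v x)"
  proof -
    have "(A *\<^sub>v x) \<bullet> (P *\<^sub>v y) = x \<bullet> (A\<^sup>T *\<^sub>v (P *\<^sub>v y))"
      using transpose_vec_mult_scalar[of "A\<^sup>T" d d "P *\<^sub>v y" x] A x Pyc by simp
    also have "A\<^sup>T *\<^sub>v (P *\<^sub>v y) = (P - Q) *\<^sub>v x"
      unfolding Py AP[symmetric] using A PM x by simp
    finally show ?thesis
      using P Q x by (simp add: minus_mult_distrib_mat_vec[of _ d d] scalar_prod_minus_distrib[of _ d])
  qed
  have 2: "(B *\<^sub>v (K *\<^sub>v x)) \<bullet> (P *\<^sub>v y) = - ((K *\<^sub>v x) \<bullet> (R *\<^sub>v (K *\<^sub>v x)))"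
  proof -
    have "(B *\<^sub>v (K *\<^sub>v x)) \<bullet> (P *\<^sub>v y) = (K *\<^sub>v x) \<bullet> (B\<^sup>T *\<^sub>v (P *\<^sub>v y))"
      using transpose_vec_mult_scalar[of "B\<^sup>T" e d "P *\<^sub>v y" "K *\<^sub>v x"] B Kx Pyc by simp
    also have "B\<^sup>T *\<^sub>v (P *\<^sub>v y) = B\<^sup>T * (P * (A + B * K)) *\<^sub>v x"
      unfolding Py using B PM x by simp
    also have "\<dots> = - (R *\<^sub>v (K *\<^sub>v x))"
      unfolding BP using R K x by simp
    finally show ?thesis
      using R K by (subst (asm) scalar_prod_uminus_right) auto
  qed
  show ?thesis
    using 1 2 A B x Kx Pyc
    by (subst y) (simp add: add_scalar_prod_distrib[of _ d])
qed

section \<open>Complexification of real matrices\<close>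

abbreviation cmat :: "real mat \<Rightarrow> complex mat" where
  "cmat \<equiv> map_mat complex_of_real"

lemma cmat_add_minus_uminus:
  assumes "X \<in> carrier_mat r c" "Y \<in> carrier_mat r c"
  shows "cmat (X + Y) = cmat X + cmat Y" "cmat (X - Y) = cmat X - cmat Y" "cmat (- X) = - cmat X"
  using assms by (auto intro!: eq_matI)

text \<open>A real matrix acts separately on real and imaginary parts. This carries real statements
  about quadratic forms and block products over to complex eigenvectors.\<close>

lemma Re_Im_mult_mat_vec:
  assumes M: "M \<in> carrier_mat p n" and v: "v \<in> carrier_vec n"
  shows "map_vec Re (cmat M *\<^sub>v v) = M *\<^sub>v map_vec Re v"
    and "map_vec Im (cmat M *\<^sub>v v) = M *\<^sub>v map_vec Im v"
  using M v by (auto intro!: eq_vecI sum.cong simp: scalar_prod_def)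

lemma complex_vec_eq_iff:
  assumes "v \<in> carrier_vec n" "w \<in> carrier_vec n"
  shows "v = w \<longleftrightarrow> map_vec Re v = map_vec Re w \<and> map_vec Im v = map_vec Im w"
  using assms by (auto simp: vec_eq_iff complex_eq_iff)

lemma complex_vec_eq_0_iff:
  assumes "v \<in> carrier_vec n"
  shows "v = 0\<^sub>v n \<longleftrightarrow> map_vec Re v = 0\<^sub>v n \<and> map_vec Im v = 0\<^sub>v n"
  using assms by (auto simp: vec_eq_iff complex_eq_iff)

lemma block_diag_cong:
  assumes "\<And>i. i \<in> {1..p} \<Longrightarrow> F i = G i"
  shows "block_diag p F = block_diag p G"
  unfolding block_diag_def using assms by (intro arg_cong[where f = diag_block_mat] map_cong) auto

text \<open>The hypothesis \<open>modes\<close> is the Hautus test for stabilizability. In this form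
  it can be verified block by block for a block diagonal pair, and it is what an unstable
  closed-loop eigenvector is shown to violate.\<close>

lemma riccati_gain_schur_stable:
  assumes d: "0 < d"
    and A: "A \<in> carrier_mat d d" and B: "B \<in> carrier_mat d e"
    and Q: "sym_pos_semidef d Q" and R: "sym_pos_def e R" and P: "sym_pos_def d P"
    and inv: "invertible_mat (R + B\<^sup>T * P * B)"
    and ric: "riccati_solution A B Q R P"
    and K: "K = riccati_gain A B R P"
    and modes: "\<And>w c. w \<in> carrier_vec d \<Longrightarrow> w \<noteq> 0\<^sub>v d \<Longrightarrow> cmat A\<^sup>T *\<^sub>v w = c \<cdot>\<^sub>v w \<Longrightarrow>
      cmat B\<^sup>T *\<^sub>v w = 0\<^sub>v e \<Longrightarrow> cmod c < 1"
  shows "schur_stable (A + B * K)"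
proof -
  have Qc: "Q \<in> carrier_mat d d" and Rc: "R \<in> carrier_mat e e" and Pc: "P \<in> carrier_mat d d"
    using Q R P by (auto simp: sym_pos_semidef_def sym_pos_def_def)
  note cl = riccati_closed_loop[OF A B Qc Rc Pc inv ric K]
  note Kc = cl(1)
  define M where "M = A + B * K"
  have M: "M \<in> carrier_mat d d" using A B Kc by (simp add: M_def)
  then have cM: "cmat M \<in> carrier_mat d d" by simp
  define f where "f x = x \<bullet> (P *\<^sub>v x)" for x
  have f0: "0 \<le> f x" if "x \<in> carrier_vec d" for x
    using P that Pc by (cases "x = 0\<^sub>v d") (auto simp: sym_pos_def_def f_def intro: less_imp_le)
  have lyap: "f (M *\<^sub>v x) = f x - x \<bullet> (Q *\<^sub>v x) - (K *\<^sub>v x) \<bullet> (R *\<^sub>v (K *\<^sub>v x))"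
    if "x \<in> carrier_vec d" for x
    unfolding f_def M_def using riccati_lyapunov[OF A B Kc Qc Rc Pc cl(2,3) that] .
  have Qx: "0 \<le> x \<bullet> (Q *\<^sub>v x)" if "x \<in> carrier_vec d" for x
    using Q that by (simp add: sym_pos_semidef_def)
  have Rx: "0 \<le> z \<bullet> (R *\<^sub>v z)" "z \<bullet> (R *\<^sub>v z) = 0 \<Longrightarrow> z = 0\<^sub>v e" if "z \<in> carrier_vec e" for z
    using R that Rc unfolding sym_pos_def_def
    by (cases "z = 0\<^sub>v e"; force)+
  have "cmod c < 1" if ev: "eigenvalue (cmat M) c" for c
  proof (rule ccontr)
    assume "\<not> cmod c < 1"
    then have c1: "1 \<le> cmod c" by simp
    then have c0: "c \<noteq> 0" by auto
    from ev obtain v where v: "v \<in> carrier_vec d" "v \<noteq> 0\<^sub>v d" and Mv: "cmat M *\<^sub>v v = c \<cdot>\<^sub>v v"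
      using M unfolding eigenvalue_def eigenvector_def by auto
    define a b where "a = map_vec Re v" and "b = map_vec Im v"
    have a: "a \<in> carrier_vec d" and b: "b \<in> carrier_vec d" using v by (auto simp: a_def b_def)
    define p q where "p = Re c" and "q = Im c"
    \<comment> \<open>Real and imaginary part of M v = c v: on the pair \<open>a\<close>,
      \<open>b\<close> the matrix acts as a rotation scaled by |c|.\<close>
    have Ma: "M *\<^sub>v a = p \<cdot>\<^sub>v a - q \<cdot>\<^sub>v b" and Mb: "M *\<^sub>v b = q \<cdot>\<^sub>v a + p \<cdot>\<^sub>v b"
      unfolding a_def b_def Re_Im_mult_mat_vec[OF M v(1), symmetric] Mv p_def q_def
      using v(1) by (auto intro!: eq_vecI)
    \<comment> \<open>The form \<open>x\<^sup>* P x\<close> on complex vectors, split into real and imaginary parts.\<close>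
    have rot: "f (M *\<^sub>v a) + f (M *\<^sub>v b) = (p\<^sup>2 + q\<^sup>2) * (f a + f b)"
    proof -
      have Pa: "P *\<^sub>v a \<in> carrier_vec d" and Pb: "P *\<^sub>v b \<in> carrier_vec d" using Pc a b by auto
      have "P *\<^sub>v (M *\<^sub>v a) = p \<cdot>\<^sub>v (P *\<^sub>v a) - q \<cdot>\<^sub>v (P *\<^sub>v b)"
        unfolding Ma using Pc a b by (simp add: mult_minus_distrib_mat_vec[of _ d d] mult_mat_vec)
      moreover have "P *\<^sub>v (M *\<^sub>v b) = q \<cdot>\<^sub>v (P *\<^sub>v a) + p \<cdot>\<^sub>v (P *\<^sub>v b)"
        unfolding Mb using Pc a b by (simp add: mult_add_distrib_mat_vec[of _ d d] mult_mat_vec)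
      ultimately show ?thesis
        unfolding f_def using a b Pa Pb
        by (simp add: Ma Mb scalar_prod_add_distrib[of _ d] add_scalar_prod_distrib[of _ d]
            scalar_prod_minus_distrib[of _ d] minus_scalar_prod_distrib[of _ d]
            power2_eq_square algebra_simps)
    qed
    have fpos: "0 < f x" if "x \<in> carrier_vec d" "x \<noteq> 0\<^sub>v d" for x
      using P that by (simp add: sym_pos_def_def f_def)
    have "a \<noteq> 0\<^sub>v d \<or> b \<noteq> 0\<^sub>v d"
      using v complex_vec_eq_0_iff[OF v(1)] by (auto simp: a_def b_def)
    then have fab: "0 < f a + f b"
      using fpos[OF a] fpos[OF b] f0[OF a] f0[OF b] by linarith
    \<comment> \<open>Since |c| >= 1 the form cannot shrink along \<open>M\<close>, while the
      Lyapunov identity forbids growth. Hence |c| <= 1, and the total loss in that identity is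
      zero.\<close>
    have "f a + f b \<le> (p\<^sup>2 + q\<^sup>2) * (f a + f b)"
    proof -
      have "1 \<le> p\<^sup>2 + q\<^sup>2"
        using c1 power_mono[of 1 "cmod c" 2] by (simp add: cmod_power2 p_def q_def)
      then show ?thesis using f0[OF a] f0[OF b] by (simp add: mult_le_cancel_right1)
    qed
    note grow = this
    have nonneg: "0 \<le> (K *\<^sub>v a) \<bullet> (R *\<^sub>v (K *\<^sub>v a))" "0 \<le> (K *\<^sub>v b) \<bullet> (R *\<^sub>v (K *\<^sub>v b))"
      using Rx(1) Kc a b by (simp_all add: mult_mat_vec_carrier[of _ e d])
    have "(p\<^sup>2 + q\<^sup>2) * (f a + f b) \<le> 1 * (f a + f b)"
      using rot lyap[OF a] lyap[OF b] Qx[OF a] Qx[OF b] nonneg by simp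
    with fab have "(cmod c)\<^sup>2 \<le> 1"
      by (simp only: mult_le_cancel_right_pos cmod_power2 p_def q_def)
    then have c2: "cmod c \<le> 1"
      by (simp add: abs_square_le_1)
    \<comment> \<open>The four losses are nonnegative with sum at most 0, so each of them
      vanishes.\<close>
    from grow rot lyap[OF a] lyap[OF b] Qx[OF a] Qx[OF b] nonneg
    have "a \<bullet> (Q *\<^sub>v a) = 0" "b \<bullet> (Q *\<^sub>v b) = 0"
      "(K *\<^sub>v a) \<bullet> (R *\<^sub>v (K *\<^sub>v a)) = 0" "(K *\<^sub>v b) \<bullet> (R *\<^sub>v (K *\<^sub>v b)) = 0"
      by simp_all
    then have "Q *\<^sub>v a = 0\<^sub>v d" "Q *\<^sub>v b = 0\<^sub>v d" "K *\<^sub>v a = 0\<^sub>v e" "K *\<^sub>v b = 0\<^sub>v e"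
      using semidef_kernel[OF Q a] semidef_kernel[OF Q b] Rx(2)[of "K *\<^sub>v a"] Rx(2)[of "K *\<^sub>v b"]
        Kc a b by (simp_all add: mult_mat_vec_carrier[of _ e d])
    then have Qv: "cmat Q *\<^sub>v v = 0\<^sub>v d" and Kv: "cmat K *\<^sub>v v = 0\<^sub>v e"
      using Qc Kc v(1) complex_vec_eq_0_iff[of "cmat Q *\<^sub>v v" d] complex_vec_eq_0_iff[of "cmat K *\<^sub>v v" e]
        Re_Im_mult_mat_vec[OF Qc v(1)] Re_Im_mult_mat_vec[OF Kc v(1)]
      by (auto simp: a_def b_def)
    \<comment> \<open>The vector P v is the candidate for a forbidden mode of the pair
      \<open>A\<close>, \<open>B\<close>.\<close>
    define w where "w = cmat P *\<^sub>v v"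
    have w: "w \<in> carrier_vec d" using Pc v by (simp add: w_def)
    have "w \<noteq> 0\<^sub>v d"
    proof
      assume "w = 0\<^sub>v d"
      then have "P *\<^sub>v a = 0\<^sub>v d" "P *\<^sub>v b = 0\<^sub>v d"
        using complex_vec_eq_0_iff[OF w] Re_Im_mult_mat_vec[OF Pc v(1)] by (auto simp: w_def a_def b_def)
      then have "f a + f b = 0" using a b by (simp add: f_def)
      with fab show False by simp
    qed
    have PMv: "cmat (P * M) *\<^sub>v v = c \<cdot>\<^sub>v w"
      using Pc M v(1) by (simp add: of_real_hom.mat_hom_mult[OF Pc M] Mv w_def mult_mat_vec)
    have PM: "P * M \<in> carrier_mat d d" using Pc M by simp
    have AT: "A\<^sup>T \<in> carrier_mat d d" and BT: "B\<^sup>T \<in> carrier_mat e d" using A B by auto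
    \<comment> \<open>Here c w = P M v, so c A^T w = A^T P M v = (P - Q) v = P v = w.\<close>
    have "c \<cdot>\<^sub>v (cmat A\<^sup>T *\<^sub>v w) = cmat (A\<^sup>T * (P * M)) *\<^sub>v v"
      using A PM v(1) w
      by (simp add: of_real_hom.mat_hom_mult[OF AT PM] PMv mult_mat_vec)
    also have "\<dots> = w"
      using Pc Qc v(1) Qv
      by (simp add: M_def cl(2) cmat_add_minus_uminus(2)[of _ d d] minus_mult_distrib_mat_vec[of _ d d] w_def)
    finally have "cmat A\<^sup>T *\<^sub>v w = (1 / c) \<cdot>\<^sub>v w"
      using c0 by (metis divide_self_if one_smult_vec smult_smult_assoc times_divide_eq_left mult_1)
    moreover have "cmat B\<^sup>T *\<^sub>v w = 0\<^sub>v e"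
    proof -
      have "c \<cdot>\<^sub>v (cmat B\<^sup>T *\<^sub>v w) = cmat (B\<^sup>T * (P * M)) *\<^sub>v v"
        using B PM v(1) w
        by (simp add: of_real_hom.mat_hom_mult[OF BT PM] PMv mult_mat_vec)
      also have "\<dots> = - (cmat R *\<^sub>v (cmat K *\<^sub>v v))"
        using Rc Kc v(1) by (simp add: M_def cl(3) of_real_hom.mat_hom_mult[OF Rc Kc] cmat_add_minus_uminus(3)[of _ e d])
      also have "\<dots> = 0\<^sub>v e" unfolding Kv using Rc by (intro eq_vecI) auto
      finally show ?thesis
        using c0 B w by (auto simp: vec_eq_iff)
    qed
    \<comment> \<open>The eigenvalue of the transpose at \<open>w\<close> is \<open>1 / c\<close>;
      the test would give |c| > 1, against \<open>c2\<close>.\<close>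
    ultimately have "cmod (1 / c) < 1" using modes w \<open>w \<noteq> 0\<^sub>v d\<close> by blast
    with c2 c0 show False by (simp add: norm_divide field_simps)
  qed
  then show ?thesis
    unfolding schur_stable_def M_def[symmetric] spectral_radius_less_iff[OF cM d] by blast
qed

section \<open>Uncontrollable modes of the agents\<close>

text \<open>A left eigenvector annihilated by the input matrix is blind to feedback: w^T (A + B F) =
  w^T A for every F. So c is also an eigenvalue of the stable closed loop.\<close>

lemma stabilizable_modes:
  assumes n: "0 < n" and A: "A \<in> carrier_mat n n" and B: "B \<in> carrier_mat n m"
    and st: "stabilizable n m A B"
    and w: "w \<in> carrier_vec n" "w \<noteq> 0\<^sub>v n"
    and Aw: "cmat A\<^sup>T *\<^sub>v w = c \<cdot>\<^sub>v w" and Bw: "cmat B\<^sup>T *\<^sub>v w = 0\<^sub>v m"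
  shows "cmod c < 1"
proof -
  from st obtain F where F: "F \<in> carrier_mat m n" and sF: "schur_stable (A + B * F)"
    unfolding stabilizable_def by blast
  define M where "M = A + B * F"
  have M: "M \<in> carrier_mat n n" using A B F by (simp add: M_def)
  have cM: "cmat M \<in> carrier_mat n n" using M by simp
  have BF: "B * F \<in> carrier_mat n n" using B F by simp
  have FB: "F\<^sup>T * B\<^sup>T \<in> carrier_mat n n" using B F by simp
  have AT: "A\<^sup>T \<in> carrier_mat n n" using A by simp
  have MT: "M\<^sup>T = A\<^sup>T + F\<^sup>T * B\<^sup>T"
    unfolding M_def using A B F BF by (simp add: transpose_add[of _ n n] transpose_mult[of _ n m])
  have FBw: "cmat (F\<^sup>T * B\<^sup>T) *\<^sub>v w = 0\<^sub>v n"
  proof -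
    have "cmat (F\<^sup>T * B\<^sup>T) *\<^sub>v w = cmat F\<^sup>T *\<^sub>v (cmat B\<^sup>T *\<^sub>v w)"
      using B F w(1) by (simp add: of_real_hom.mat_hom_mult[of "F\<^sup>T" n m "B\<^sup>T" n])
    moreover have "cmat F\<^sup>T *\<^sub>v 0\<^sub>v m = 0\<^sub>v n" using F by (intro eq_vecI) auto
    ultimately show ?thesis by (simp add: Bw)
  qed
  have "cmat M\<^sup>T *\<^sub>v w = c \<cdot>\<^sub>v w"
    unfolding MT cmat_add_minus_uminus(1)[OF AT FB]
    using AT FB w(1) Aw FBw by (simp add: add_mult_distrib_mat_vec[of _ n n])
  then have "eigenvalue (cmat M\<^sup>T) c"
    unfolding eigenvalue_def eigenvector_def using w M by auto
  then have "eigenvalue (cmat M) c"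
    using eigenvalue_transpose[OF cM] by (simp add: map_mat_transpose)
  then show ?thesis
    using sF spectral_radius_less_iff[OF cM n] unfolding schur_stable_def M_def by blast
qed

lemma vec_block_diag_mult:
  assumes F: "\<And>i. i \<in> {1..p} \<Longrightarrow> F i \<in> carrier_mat r c" and v: "v \<in> carrier_vec (p * c)"
    and i: "i \<in> {1..p}"
  shows "vec_block r (block_diag p F *\<^sub>v v) i = F i *\<^sub>v vec_block c v i"
proof -
  have "block_diag p F *\<^sub>v v = block_vec p r (\<lambda>i. F i *\<^sub>v vec_block c v i)"
    using block_diag_mult_block_vec[of p F r c "vec_block c v"] F v
    by (simp add: block_vec_vec_block)
  then show ?thesis
    using F[OF i] block_vec_index_block[OF i, of _ r] by (intro eq_vecI) (auto simp: vec_block_def)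
qed

text \<open>Since \<open>block_vec\<close> is real, the complex case is reduced to
  \<open>vec_block_diag_mult\<close> by comparing real and imaginary parts.\<close>

lemma vec_block_complex_block_diag_mult:
  assumes F: "\<And>i. i \<in> {1..p} \<Longrightarrow> F i \<in> carrier_mat r c" and v: "v \<in> carrier_vec (p * c)"
    and i: "i \<in> {1..p}"
  shows "vec_block r (cmat (block_diag p F) *\<^sub>v v) i = cmat (F i) *\<^sub>v vec_block c v i"
proof -
  have D: "block_diag p F \<in> carrier_mat (p * r) (p * c)" using F by (rule block_diag_carrier)
  have blk: "map_vec g (vec_block k u i) = vec_block k (map_vec g u) i"
    if "u \<in> carrier_vec (p * k)" for g :: "complex \<Rightarrow> real" and k u
    using that block_index_less[OF i, of _ k] by (intro eq_vecI) (auto simp: vec_block_def)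
  have Dv: "cmat (block_diag p F) *\<^sub>v v \<in> carrier_vec (p * r)" using D v by simp
  have FB: "cmat (F i) *\<^sub>v vec_block c v i \<in> carrier_vec r" using F[OF i] by auto
  show ?thesis
    unfolding complex_vec_eq_iff[OF vec_block_carrier FB] blk[OF Dv] Re_Im_mult_mat_vec[OF D v]
      Re_Im_mult_mat_vec[OF F[OF i] vec_block_carrier] blk[OF v]
    using vec_block_diag_mult[of p F r c, OF F _ i] v by simp
qed

lemma vec_block_nonzero:
  assumes w: "w \<in> carrier_vec (p * r)" "w \<noteq> 0\<^sub>v (p * r)"
  obtains i where "i \<in> {1..p}" "vec_block r w i \<noteq> 0\<^sub>v r"
proof -
  have "\<exists>i\<in>{1..p}. vec_block r w i \<noteq> 0\<^sub>v r"
  proof (rule ccontr)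
    assume "\<not> ?thesis"
    then have z: "vec_block r w i = 0\<^sub>v r" if "i \<in> {1..p}" for i using that by blast
    have "w = 0\<^sub>v (p * r)"
    proof (rule eq_vecI)
      fix k assume "k < dim_vec (0\<^sub>v (p * r) :: 'a vec)"
      then have k: "k < p * r" by simp
      have "vec_block r w (Suc (k div r)) $ (k mod r) = 0"
        using z[OF block_of_index(1)[OF k]] block_of_index(2)[OF k] by simp
      then show "w $ k = 0\<^sub>v (p * r) $ k"
        using k block_of_index(2)[OF k] by (simp add: vec_block_def)
    qed (use w in simp)
    with w show False by simp
  qed
  then show ?thesis using that by blast
qed

text \<open>Both equations for \<open>w\<close> decouple along the blocks with the same c, so any
  nonzero block of \<open>w\<close> is a mode of a single agent.\<close>

lemma block_diag_stabilizable_modes: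
  assumes n: "0 < n"
    and A: "\<And>i. i \<in> {1..p} \<Longrightarrow> A i \<in> carrier_mat n n" and B: "\<And>i. i \<in> {1..p} \<Longrightarrow> B i \<in> carrier_mat n m"
    and st: "\<And>i. i \<in> {1..p} \<Longrightarrow> stabilizable n m (A i) (B i)"
    and w: "w \<in> carrier_vec (p * n)" "w \<noteq> 0\<^sub>v (p * n)"
    and Aw: "cmat (block_diag p A)\<^sup>T *\<^sub>v w = c \<cdot>\<^sub>v w"
    and Bw: "cmat (block_diag p B)\<^sup>T *\<^sub>v w = 0\<^sub>v (p * m)"
  shows "cmod c < 1"
proof -
  from vec_block_nonzero[OF w] obtain i where i: "i \<in> {1..p}" and wi: "vec_block n w i \<noteq> 0\<^sub>v n" .
  have A': "(A i)\<^sup>T \<in> carrier_mat n n" and B': "(B i)\<^sup>T \<in> carrier_mat m n" if "i \<in> {1..p}" for i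
    using A[OF that] B[OF that] by auto
  have AT: "(block_diag p A)\<^sup>T = block_diag p (\<lambda>i. (A i)\<^sup>T)"
    and BT: "(block_diag p B)\<^sup>T = block_diag p (\<lambda>i. (B i)\<^sup>T)"
    using block_diag_transpose[of p A n n] block_diag_transpose[of p B n m] A B by blast+
  have "cmat (A i)\<^sup>T *\<^sub>v vec_block n w i = vec_block n (c \<cdot>\<^sub>v w) i"
    unfolding Aw[symmetric] AT
    using vec_block_complex_block_diag_mult[of p "\<lambda>i. (A i)\<^sup>T" n n w i] A' w(1) i by simp
  also have "\<dots> = c \<cdot>\<^sub>v vec_block n w i"
    using w(1) block_index_less[OF i, of _ n] by (intro eq_vecI) (auto simp: vec_block_def)
  finally have 1: "cmat (A i)\<^sup>T *\<^sub>v vec_block n w i = c \<cdot>\<^sub>v vec_block n w i" .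
  have "cmat (B i)\<^sup>T *\<^sub>v vec_block n w i = vec_block m (0\<^sub>v (p * m)) i"
    unfolding Bw[symmetric] BT
    using vec_block_complex_block_diag_mult[of p "\<lambda>i. (B i)\<^sup>T" m n w i] B' w(1) i by simp
  also have "\<dots> = 0\<^sub>v m"
    using block_index_less[OF i, of _ m] by (intro eq_vecI) (auto simp: vec_block_def)
  finally show ?thesis
    using stabilizable_modes[OF n A[OF i] B[OF i] st[OF i] vec_block_carrier wi 1] by blast
qed

section \<open>Definiteness of block diagonal weights\<close>

text \<open>The form decouples into the forms of the blocks, so definiteness of the local weights
  lifts to the global ones.\<close>

lemma block_diag_quadratic_form:
  assumes F: "\<And>i. i \<in> {1..p} \<Longrightarrow> F i \<in> carrier_mat r r" and v: "v \<in> carrier_vec (p * r)"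
  shows "v \<bullet> (block_diag p F *\<^sub>v v) = (\<Sum>i\<in>{1..p}. vec_block r v i \<bullet> (F i *\<^sub>v vec_block r v i))"
proof -
  let ?v = "vec_block r v"
  have "v \<bullet> (block_diag p F *\<^sub>v v) = block_vec p r ?v \<bullet> (block_diag p F *\<^sub>v block_vec p r ?v)"
    using v by (simp add: block_vec_vec_block)
  also have "\<dots> = block_vec p r ?v \<bullet> block_vec p r (\<lambda>i. F i *\<^sub>v ?v i)"
    using block_diag_mult_block_vec[of p F r r ?v] F by simp
  also have "\<dots> = (\<Sum>i\<in>{1..p}. ?v i \<bullet> (F i *\<^sub>v ?v i))"
    by (rule scalar_prod_block_vec) (use mult_mat_vec_carrier[OF F vec_block_carrier] in blast)
  finally show ?thesis .
qed

lemma block_diag_symmetric: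
  assumes F: "\<And>i. i \<in> {1..p} \<Longrightarrow> F i \<in> carrier_mat r r" and sym: "\<And>i. i \<in> {1..p} \<Longrightarrow> (F i)\<^sup>T = F i"
  shows "(block_diag p F)\<^sup>T = block_diag p F"
  using block_diag_transpose[of p F r r] block_diag_cong[of p "\<lambda>i. (F i)\<^sup>T" F] F sym by metis

lemma block_diag_pos_def:
  assumes F: "\<And>i. i \<in> {1..p} \<Longrightarrow> sym_pos_def r (F i)"
  shows "sym_pos_def (p * r) (block_diag p F)"
proof -
  have Fc: "F i \<in> carrier_mat r r" "(F i)\<^sup>T = F i" if "i \<in> {1..p}" for i
    using F[OF that] by (auto simp: sym_pos_def_def)
  have nonneg: "0 \<le> v \<bullet> (F i *\<^sub>v v)" if "i \<in> {1..p}" "v \<in> carrier_vec r" for i v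
    using F[OF that(1)] that Fc(1)[OF that(1)]
    by (cases "v = 0\<^sub>v r") (auto simp: sym_pos_def_def intro: less_imp_le)
  have "0 < v \<bullet> (block_diag p F *\<^sub>v v)" if v: "v \<in> carrier_vec (p * r)" "v \<noteq> 0\<^sub>v (p * r)" for v
  proof -
    from vec_block_nonzero[OF v] obtain i where i: "i \<in> {1..p}" "vec_block r v i \<noteq> 0\<^sub>v r" .
    have "0 < (\<Sum>i\<in>{1..p}. vec_block r v i \<bullet> (F i *\<^sub>v vec_block r v i))"
      using i nonneg F[OF i(1)] by (intro sum_pos2[of _ i]) (auto simp: sym_pos_def_def)
    then show ?thesis using block_diag_quadratic_form[of p F r v] Fc(1) v(1) by simp
  qed
  then show ?thesis
    using block_diag_carrier[of p F r r] block_diag_symmetric[of p F r] Fc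
    by (simp add: sym_pos_def_def)
qed

lemma block_diag_pos_semidef:
  assumes F: "\<And>i. i \<in> {1..p} \<Longrightarrow> sym_pos_semidef r (F i)"
  shows "sym_pos_semidef (p * r) (block_diag p F)"
proof -
  have Fc: "F i \<in> carrier_mat r r" "(F i)\<^sup>T = F i" if "i \<in> {1..p}" for i
    using F[OF that] by (auto simp: sym_pos_semidef_def)
  have "0 \<le> v \<bullet> (block_diag p F *\<^sub>v v)" if v: "v \<in> carrier_vec (p * r)" for v
  proof -
    have "0 \<le> (\<Sum>i\<in>{1..p}. vec_block r v i \<bullet> (F i *\<^sub>v vec_block r v i))"
      using F by (intro sum_nonneg) (auto simp: sym_pos_semidef_def)
    then show ?thesis using block_diag_quadratic_form[of p F r v] Fc(1) v by simp
  qed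
  then show ?thesis
    using block_diag_carrier[of p F r r] block_diag_symmetric[of p F r] Fc
    by (simp add: sym_pos_semidef_def)
qed

section \<open>Tracking and observer errors\<close>

text \<open>The lower blocks in \<open>hconcat\<close> have no rows, so the second part of the
  product is the empty vector.\<close>

lemma hconcat_mult_append:
  assumes "M \<in> carrier_mat r c" "M' \<in> carrier_mat r c'" "v \<in> carrier_vec c" "v' \<in> carrier_vec c'"
  shows "hconcat M M' *\<^sub>v (v @\<^sub>v v') = M *\<^sub>v v + M' *\<^sub>v v'"
proof -
  have "hconcat M M' *\<^sub>v (v @\<^sub>v v')
      = (M *\<^sub>v v + M' *\<^sub>v v') @\<^sub>v (0\<^sub>m 0 c *\<^sub>v v + 0\<^sub>m 0 c' *\<^sub>v v')"
    unfolding hconcat_def using assms by (subst four_block_mat_mult_vec[of _ r c _ c' _ 0]) auto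
  then show ?thesis using assms by (auto intro!: eq_vecI)
qed

lemma feedforward1_cancels:
  assumes A: "A i \<in> carrier_mat n n" "A j \<in> carrier_mat n n"
    and B: "B i \<in> carrier_mat n m" "B j \<in> carrier_mat n m"
    and x: "x j k \<in> carrier_vec n" and u: "u j k \<in> carrier_vec m"
    and ff: "feedforward1 A B x u i j ut"
  shows "ut k \<in> carrier_vec m" "B i *\<^sub>v ut k = B j *\<^sub>v u j k - (A i - A j) *\<^sub>v x j k"
proof -
  from ff have inv: "invertible_mat (B i)"
    and ut: "ut k = - (inv_mat (B i) *\<^sub>v ((A i - A j) *\<^sub>v x j k)) + inv_mat (B i) *\<^sub>v (B j *\<^sub>v u j k)"
    unfolding feedforward1_def by auto
  \<comment> \<open>Invertibility includes being square, so state and input dimensions agree in this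
    case.\<close>
  have nm: "m = n" using inv B(1) unfolding invertible_mat_def square_mat.simps by auto
  define X where "X = inv_mat (B i)"
  have X: "X \<in> carrier_mat n n" "B i * X = 1\<^sub>m n"
    using inv_mat_inverse[of "B i" n] inv B(1) nm by (auto simp: X_def)
  define y z where "y = (A i - A j) *\<^sub>v x j k" and "z = B j *\<^sub>v u j k"
  have yz: "y \<in> carrier_vec n" "z \<in> carrier_vec n"
    unfolding y_def z_def using A B x u by (auto intro!: mult_mat_vec_carrier)
  have ut: "ut k = X *\<^sub>v (z - y)"
    unfolding ut X_def[symmetric] y_def[symmetric] z_def[symmetric]
    using X yz by (simp add: mult_minus_distrib_mat_vec[of _ n n]) (auto intro!: eq_vecI)
  then show "ut k \<in> carrier_vec m" using X yz nm by simp
  show "B i *\<^sub>v ut k = B j *\<^sub>v u j k - (A i - A j) *\<^sub>v x j k"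
    unfolding ut y_def[symmetric] z_def[symmetric]
    using B(1) X yz nm by (simp flip: assoc_mult_mat_vec[of _ n n _ n])
qed

text \<open>The equation B X B = B says that B X is the identity on the range of B. The range
  condition puts the vector to be cancelled there, and the free term disappears because B (1 - X B)
  = 0.\<close>

lemma feedforward2_cancels:
  assumes A: "A i \<in> carrier_mat n n" "A j \<in> carrier_mat n n"
    and B: "B i \<in> carrier_mat n m" "B j \<in> carrier_mat n m"
    and x: "x j k \<in> carrier_vec n" and u: "u j k \<in> carrier_vec m"
    and ff: "feedforward2 m A B x u i j ut"
  shows "ut k \<in> carrier_vec m" "B i *\<^sub>v ut k = B j *\<^sub>v u j k - (A i - A j) *\<^sub>v x j k"
proof -
  from ff obtain X z where mp: "is_moore_penrose (B i) X" and z: "z k \<in> carrier_vec m"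
    and ut: "ut k = - (X *\<^sub>v ((A i - A j) *\<^sub>v x j k - B j *\<^sub>v u j k)) + (1\<^sub>m m - X * B i) *\<^sub>v z k"
    and rng: "mat_range (hconcat (A j - A i) (B j)) \<subseteq> mat_range (B i)"
    unfolding feedforward2_def by blast
  have X: "X \<in> carrier_mat m n" "B i * X * B i = B i"
    using mp B(1) unfolding is_moore_penrose_def by auto
  define y where "y = (A i - A j) *\<^sub>v x j k - B j *\<^sub>v u j k"
  have "(A i - A j) *\<^sub>v x j k \<in> carrier_vec n" "B j *\<^sub>v u j k \<in> carrier_vec n"
    using A B x u by (auto intro!: mult_mat_vec_carrier)
  then have y: "y \<in> carrier_vec n" unfolding y_def by simp
  have XB: "X * B i \<in> carrier_mat m m" using X(1) B(1) by auto
  have c: "X *\<^sub>v y \<in> carrier_vec m" "(1\<^sub>m m - X * B i) *\<^sub>v z k \<in> carrier_vec m"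
    using mult_mat_vec_carrier[OF X(1) y] mult_mat_vec_carrier[OF minus_carrier_mat[OF XB] z] by auto
  then show "ut k \<in> carrier_vec m" unfolding ut y_def[symmetric] by simp
  \<comment> \<open>The concatenation contains A j - A i, so applying it to the stacked parent state
    and input gives \<open>- y\<close> and not \<open>y\<close>.\<close>
  have "- y \<in> mat_range (hconcat (A j - A i) (B j))"
  proof -
    have "- y = (A j - A i) *\<^sub>v x j k + B j *\<^sub>v u j k"
      unfolding y_def using A B x u
      by (auto intro!: eq_vecI simp: minus_mult_distrib_mat_vec[of _ n n])
    also have "\<dots> = hconcat (A j - A i) (B j) *\<^sub>v (x j k @\<^sub>v u j k)"
      using A B x u by (intro hconcat_mult_append[symmetric]) auto
    finally have "- y = hconcat (A j - A i) (B j) *\<^sub>v (x j k @\<^sub>v u j k)" .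
    moreover have "dim_col (hconcat (A j - A i) (B j)) = n + m"
      using A B by (simp add: hconcat_def)
    ultimately show ?thesis unfolding mat_range_def using x u by auto
  qed
  with rng obtain s where s: "s \<in> carrier_vec m" "- y = B i *\<^sub>v s"
    using B(1) unfolding mat_range_def by auto
  have BX: "B i * X \<in> carrier_mat n n" using B(1) X(1) by auto
  have BXy: "B i *\<^sub>v (X *\<^sub>v y) = y"
  proof -
    have "y = - (B i *\<^sub>v s)" unfolding s(2)[symmetric] by simp
    also have "\<dots> = B i *\<^sub>v (- s)" using B(1) s(1) by (auto intro!: eq_vecI)
    finally have ys: "y = B i *\<^sub>v (- s)" .
    have "B i *\<^sub>v (X *\<^sub>v y) = B i * X *\<^sub>v y"
      using B(1) X(1) y by (rule assoc_mult_mat_vec[symmetric])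
    also have "\<dots> = B i * X * B i *\<^sub>v (- s)"
      unfolding ys using BX B(1) s(1) by (intro assoc_mult_mat_vec[symmetric]) auto
    finally show ?thesis unfolding X(2) ys .
  qed
  have "B i *\<^sub>v ((1\<^sub>m m - X * B i) *\<^sub>v z k) = B i *\<^sub>v z k - B i *\<^sub>v (X * B i *\<^sub>v z k)"
    using B XB z by (simp add: minus_mult_distrib_mat_vec[of _ m m] mult_minus_distrib_mat_vec[of _ n m])
  also have "B i *\<^sub>v (X * B i *\<^sub>v z k) = B i * X * B i *\<^sub>v z k"
    unfolding assoc_mult_mat[OF B(1) X(1) B(1)] using B(1) XB z by (rule assoc_mult_mat_vec[symmetric])
  finally have Bz: "B i *\<^sub>v ((1\<^sub>m m - X * B i) *\<^sub>v z k) = 0\<^sub>v n"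
    unfolding X(2) using B z by simp
  have "B i *\<^sub>v ut k = - y"
    unfolding ut y_def[symmetric] mult_add_distrib_mat_vec[OF B(1) uminus_carrier_vec[THEN iffD2, OF c(1)] c(2)] Bz
    using B(1) c(1) y BXy mult_minus_distrib_mat_vec[OF B(1) zero_carrier_vec c(1)]
    by (auto intro!: eq_vecI)
  also have "\<dots> = B j *\<^sub>v u j k - (A i - A j) *\<^sub>v x j k"
    unfolding y_def using A B x u by (auto intro!: eq_vecI)
  finally show "B i *\<^sub>v ut k = B j *\<^sub>v u j k - (A i - A j) *\<^sub>v x j k" .
qed

text \<open>From A_i x_i - A_j x_j = A_i (x_i - x_j) + (A_i - A_j) x_j, the surplus term and the
  parent input B_j u_j are exactly what the feedforward cancels.\<close>

lemma tracking_error_step: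
  fixes Ai Aj Bi Bj :: "real mat"
  assumes A: "Ai \<in> carrier_mat n n" "Aj \<in> carrier_mat n n"
    and B: "Bi \<in> carrier_mat n m" "Bj \<in> carrier_mat n m"
    and x: "xi \<in> carrier_vec n" "xj \<in> carrier_vec n"
    and u: "ut \<in> carrier_vec m" "ub \<in> carrier_vec m" "uj \<in> carrier_vec m"
    and ff: "Bi *\<^sub>v ut = Bj *\<^sub>v uj - (Ai - Aj) *\<^sub>v xj"
  shows "(Ai *\<^sub>v xi + Bi *\<^sub>v (ut + ub)) - (Aj *\<^sub>v xj + Bj *\<^sub>v uj) = Ai *\<^sub>v (xi - xj) + Bi *\<^sub>v ub"
proof -
  define a b c d e where "a = Ai *\<^sub>v xi" and "b = Bi *\<^sub>v ub" and "c = Aj *\<^sub>v xj"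
    and "d = Bj *\<^sub>v uj" and "e = Ai *\<^sub>v xj"
  have car: "a \<in> carrier_vec n" "b \<in> carrier_vec n" "c \<in> carrier_vec n" "d \<in> carrier_vec n" "e \<in> carrier_vec n"
    unfolding a_def b_def c_def d_def e_def using A B x u by auto
  have 1: "Bi *\<^sub>v (ut + ub) = (d - (e - c)) + b"
    using B u ff A x by (simp add: mult_add_distrib_mat_vec[of _ n m] minus_mult_distrib_mat_vec[of _ n n]
        b_def c_def d_def e_def)
  have 2: "Ai *\<^sub>v (xi - xj) = a - e"
    using A x by (simp add: mult_minus_distrib_mat_vec[of _ n n] a_def e_def)
  show ?thesis
    unfolding 1 2 a_def[symmetric] b_def[symmetric] c_def[symmetric] d_def[symmetric]
    using car by (intro eq_vecI) auto
qed

lemma stacked_error_step: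
  assumes A: "\<And>i. i \<in> {0..N} \<Longrightarrow> A i \<in> carrier_mat n n"
    and B: "\<And>i. i \<in> {0..N} \<Longrightarrow> B i \<in> carrier_mat n m"
    and B0: "B 0 = 0\<^sub>m n m"
    and par: "\<And>i. i \<in> {1..N} \<Longrightarrow> par i \<in> {0..N}"
    and dyn: "agent_dynamics N n m A B x u"
    and ff: "\<And>i. i \<in> {1..N} \<Longrightarrow>
      feedforward1 A B x u i (par i) (ut i) \<or> feedforward2 m A B x u i (par i) (ut i)"
    and ub: "\<And>i k. i \<in> {1..N} \<Longrightarrow> ub i k \<in> carrier_vec m"
    and u: "\<And>i k. i \<in> {1..N} \<Longrightarrow> u i k = ut i k + ub i k"
  shows "stacked_error N n par x (Suc k) =
    block_diag N A *\<^sub>v stacked_error N n par x k + block_diag N B *\<^sub>v block_vec N m (\<lambda>i. ub i k)"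
proof -
  have x: "x i k \<in> carrier_vec n" "u i k \<in> carrier_vec m" if "i \<in> {0..N}" for i k
    using dyn that by (cases "i = 0"; force simp: agent_dynamics_def)+
  \<comment> \<open>With B 0 = 0 and zero input the leader obeys the same equation as a follower, so
    a parent that is the root needs no separate treatment.\<close>
  have step: "x i (Suc k) = A i *\<^sub>v x i k + B i *\<^sub>v u i k" if "i \<in> {0..N}" for i
  proof (cases "i = 0")
    case True
    moreover have "0\<^sub>m n m *\<^sub>v 0\<^sub>v m = (0\<^sub>v n :: real vec)" by (intro eq_vecI) auto
    moreover have "A 0 *\<^sub>v x 0 k \<in> carrier_vec n" using A[of 0] x(1)[of 0] by auto
    ultimately show ?thesis using dyn by (simp add: agent_dynamics_def B0)
  next
    case False
    then show ?thesis using dyn that by (simp add: agent_dynamics_def)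
  qed
  let ?e = "\<lambda>i. x i k - x (par i) k"
  have e: "x i (Suc k) - x (par i) (Suc k) = A i *\<^sub>v ?e i + B i *\<^sub>v ub i k" if i: "i \<in> {1..N}" for i
  proof -
    have i0: "i \<in> {0..N}" using i by simp
    note p = par[OF i]
    have "ut i k \<in> carrier_vec m \<and>
        B i *\<^sub>v ut i k = B (par i) *\<^sub>v u (par i) k - (A i - A (par i)) *\<^sub>v x (par i) k"
      using ff[OF i] feedforward1_cancels[where A = A and B = B and x = x and u = u,
            OF A[OF i0] A[OF p] B[OF i0] B[OF p] x(1)[OF p] x(2)[OF p]]
        feedforward2_cancels[where A = A and B = B and x = x and u = u,
            OF A[OF i0] A[OF p] B[OF i0] B[OF p] x(1)[OF p] x(2)[OF p]] by blast
    then show ?thesis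
      unfolding step[OF i0] step[OF p] u[OF i]
      by (intro tracking_error_step[OF A[OF i0] A[OF p] B[OF i0] B[OF p] x(1)[OF i0] x(1)[OF p]])
        (use ub[OF i] x(2)[OF p] in auto)
  qed
  have AD: "A i \<in> carrier_mat n n" and BD: "B i \<in> carrier_mat n m" and ec: "?e i \<in> carrier_vec n"
    if "i \<in> {1..N}" for i using A[of i] B[of i] x(1)[of i] x(1)[OF par[OF that]] that by auto
  have Bub: "B i *\<^sub>v ub i k \<in> carrier_vec n" if "i \<in> {1..N}" for i
    using BD[OF that] ub[OF that] by auto
  have "block_diag N A *\<^sub>v stacked_error N n par x k + block_diag N B *\<^sub>v block_vec N m (\<lambda>i. ub i k)
      = block_vec N n (\<lambda>i. A i *\<^sub>v ?e i) + block_vec N n (\<lambda>i. B i *\<^sub>v ub i k)"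
    using block_diag_mult_block_vec[of N A n n ?e] block_diag_mult_block_vec[of N B n m "\<lambda>i. ub i k"]
      AD BD ec ub by (simp add: stacked_error_def)
  also have "\<dots> = block_vec N n (\<lambda>i. A i *\<^sub>v ?e i + B i *\<^sub>v ub i k)"
    using Bub by (rule block_vec_add)
  also have "\<dots> = stacked_error N n par x (Suc k)"
    unfolding stacked_error_def by (rule block_vec_cong) (simp add: e)
  finally show ?thesis by simp
qed

section \<open>The observer error system\<close>

text \<open>Subtract the true error dynamics from observer i. Its own input cancels, and each other
  agent l leaves B_l K_l (Eh_i - Eh_l) = B_l K_l (eps_i - eps_l). The terms in eps_i add up to
  \<open>Theta\<close>, those in eps_l form the block (i, l).\<close>

lemma observer_error_step:
  assumes At: "At \<in> carrier_mat (N * n) (N * n)" and Bt: "Bt \<in> carrier_mat (N * n) (N * m)"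
    and K: "K \<in> carrier_mat (N * m) (N * n)"
    and H: "\<And>i. i \<in> {1..N} \<Longrightarrow> H i \<in> carrier_mat (q i * n) (N * n)"
    and L: "\<And>i. i \<in> {1..N} \<Longrightarrow> L i \<in> carrier_mat (N * n) (q i * n)"
    and E: "\<And>k. E k \<in> carrier_vec (N * n)"
    and obs: "observer_dynamics N n m At Bt K L H ub E Eh"
    and ub: "\<And>i k. i \<in> {1..N} \<Longrightarrow> ub i k = block_row m K i *\<^sub>v Eh i k"
    and E_step: "\<And>k. E (Suc k) = At *\<^sub>v E k + Bt *\<^sub>v block_vec N m (\<lambda>i. ub i k)"
  shows "block_vec N (N * n) (\<lambda>i. Eh i (Suc k) - E (Suc k)) =
    observer_error_mat N n m At Bt K L H *\<^sub>v block_vec N (N * n) (\<lambda>i. Eh i k - E k)"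
    (is "_ = ?Ac *\<^sub>v block_vec _ _ ?eps")
proof (rule block_vec_eqI[symmetric])
  show "?Ac *\<^sub>v block_vec N (N * n) ?eps \<in> carrier_vec (N * (N * n))"
    unfolding observer_error_mat_def by (meson block_mat_carrier block_vec_carrier mult_mat_vec_carrier)
next
  fix i a assume i: "i \<in> {1..N}" and a: "a < N * n"
  have Eh: "Eh l k \<in> carrier_vec (N * n)" if "l \<in> {1..N}" for l k
    using obs that unfolding observer_dynamics_def by blast
  have eps: "?eps l \<in> carrier_vec (N * n)" if "l \<in> {1..N}" for l using Eh[OF that] E by simp
  note bc = block_col_carrier[OF Bt, of m] and br = block_row_carrier[OF K, of m]
  \<comment> \<open>The identity is checked in one row \<open>a\<close>, where all matrix terms
    become real numbers and sums over agents.\<close>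
  define w where "w l v = (block_col m Bt l *\<^sub>v (block_row m K l *\<^sub>v v)) $ a" for l v
  have W: "block_col m Bt l * block_row m K l \<in> carrier_mat (N * n) (N * n)" for l
    using bc br by (rule mult_carrier_mat)
  have WW: "block_col m Bt l * block_row m K l *\<^sub>v v = block_col m Bt l *\<^sub>v (block_row m K l *\<^sub>v v)"
    if "v \<in> carrier_vec (N * n)" for l v
    using bc br that by (rule assoc_mult_mat_vec)
  have wc: "block_col m Bt l *\<^sub>v (block_row m K l *\<^sub>v v) \<in> carrier_vec (N * n)"
    if "v \<in> carrier_vec (N * n)" for l v
    using bc br that by (meson mult_mat_vec_carrier)
  have wd: "w l (v - v') = w l v - w l v'"
    if "v \<in> carrier_vec (N * n)" "v' \<in> carrier_vec (N * n)" for l v v'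
    unfolding w_def mult_minus_distrib_mat_vec[OF br that]
      mult_minus_distrib_mat_vec[OF bc mult_mat_vec_carrier[OF br that(1)] mult_mat_vec_carrier[OF br that(2)]]
    using carrier_vecD[OF wc[OF that(1)]] carrier_vecD[OF wc[OF that(2)]] a by simp
  have BK: "(Bt *\<^sub>v (K *\<^sub>v v)) $ a = (\<Sum>l\<in>{1..N}. w l v)" if "v \<in> carrier_vec (N * n)" for v
    unfolding mult_mat_vec_block_rows[OF K that] w_def
    using that br by (intro mult_block_vec_block_cols[OF Bt a]) (meson mult_mat_vec_carrier)
  note Hi = H[OF i] and Li = L[OF i]
  have LH: "L l * H l \<in> carrier_mat (N * n) (N * n)" if "l \<in> {1..N}" for l
    using H[OF that] L[OF that] by auto
  have BKc: "Bt * K \<in> carrier_mat (N * n) (N * n)" using Bt K by auto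
  have Th: "Theta At Bt K m L H l \<in> carrier_mat (N * n) (N * n)" if "l \<in> {1..N}" for l
    unfolding Theta_def using LH[OF that] by (rule minus_carrier_mat)
  have sum_split: "(\<Sum>l\<in>{1..N}. g l) = g i + (\<Sum>l\<in>{1..N} - {i}. g l)" for g :: "nat \<Rightarrow> real"
    using i by (intro sum.remove) auto
  define hE where "hE = (L i *\<^sub>v (H i *\<^sub>v E k - H i *\<^sub>v Eh i k)) $ a"
  have "(?Ac *\<^sub>v block_vec N (N * n) ?eps) $ ((i - 1) * (N * n) + a)
      = (\<Sum>l\<in>{1..N}. ((if l = i then Theta At Bt K m L H i else - (block_col m Bt l * block_row m K l)) *\<^sub>v ?eps l) $ a)"
    unfolding observer_error_mat_def
    by (subst block_mat_mult_block_vec[OF _ eps i a]) (use Th W in auto)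
  also have "\<dots> = (Theta At Bt K m L H i *\<^sub>v ?eps i) $ a - (\<Sum>l\<in>{1..N} - {i}. w l (?eps l))"
  proof -
    have "((- (block_col m Bt l * block_row m K l)) *\<^sub>v ?eps l) $ a = - w l (?eps l)" if "l \<in> {1..N}" for l
      using uminus_mult_mat_vec[of "?eps l" "block_col m Bt l * block_row m K l"]
        carrier_vecD[OF eps[OF that]] carrier_matD[OF W[of l]] WW[OF eps[OF that], of l] a
      by (simp add: w_def)
    then show ?thesis unfolding sum_split by (simp add: sum_negf)
  qed
  also have "(Theta At Bt K m L H i *\<^sub>v ?eps i) $ a
      = (At *\<^sub>v ?eps i) $ a + (\<Sum>l\<in>{1..N}. w l (?eps i)) - w i (?eps i) + hE"
  proof -
    note ei = eps[OF i]
    have "Theta At Bt K m L H i *\<^sub>v ?eps i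
        = At *\<^sub>v ?eps i + Bt *\<^sub>v (K *\<^sub>v ?eps i) - block_col m Bt i *\<^sub>v (block_row m K i *\<^sub>v ?eps i)
          - L i * H i *\<^sub>v ?eps i"
      unfolding Theta_def minus_mult_distrib_mat_vec[OF minus_carrier_mat[OF W] LH[OF i] ei]
        minus_mult_distrib_mat_vec[OF add_carrier_mat[OF BKc] W ei]
        add_mult_distrib_mat_vec[OF At BKc ei] WW[OF ei] assoc_mult_mat_vec[OF Bt K ei] ..
    \<comment> \<open>The innovation is formed from E - Eh, whereas the observer error is Eh - E;
      hence the sign.\<close>
    moreover have "L i * H i *\<^sub>v ?eps i = - (L i *\<^sub>v (H i *\<^sub>v E k - H i *\<^sub>v Eh i k))"
    proof -
      have HE: "H i *\<^sub>v E k \<in> carrier_vec (q i * n)" "H i *\<^sub>v Eh i k \<in> carrier_vec (q i * n)"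
        using Hi E Eh[OF i] by auto
      have LHE: "L i *\<^sub>v (H i *\<^sub>v E k) \<in> carrier_vec (N * n)" "L i *\<^sub>v (H i *\<^sub>v Eh i k) \<in> carrier_vec (N * n)"
        using Li HE by auto
      have "L i * H i *\<^sub>v ?eps i = L i *\<^sub>v (H i *\<^sub>v Eh i k) - L i *\<^sub>v (H i *\<^sub>v E k)"
        using assoc_mult_mat_vec[OF Li Hi ei]
        unfolding mult_minus_distrib_mat_vec[OF Hi Eh[OF i] E] mult_minus_distrib_mat_vec[OF Li HE(2,1)] .
      then show ?thesis
        unfolding mult_minus_distrib_mat_vec[OF Li HE] using LHE by (auto intro!: eq_vecI)
    qed
    moreover have "At *\<^sub>v ?eps i \<in> carrier_vec (N * n)" "Bt *\<^sub>v (K *\<^sub>v ?eps i) \<in> carrier_vec (N * n)"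
      "L i *\<^sub>v (H i *\<^sub>v E k - H i *\<^sub>v Eh i k) \<in> carrier_vec (N * n)"
      using At Bt K Li Hi ei E Eh[OF i] by (auto intro!: mult_mat_vec_carrier)
    ultimately show ?thesis
      using a BK[OF ei] carrier_vecD[OF wc[OF ei, of i]] unfolding w_def hE_def
      by (simp del: dim_mult_mat_vec index_mult_mat_vec)
  qed
  also have "\<dots> - (\<Sum>l\<in>{1..N} - {i}. w l (?eps l)) = (Eh i (Suc k) - E (Suc k)) $ a"
  proof -
    let ?S = "finsum_vec TYPE(real) (N * n) (\<lambda>l. block_col m Bt l *\<^sub>v (block_row m K l *\<^sub>v Eh i k)) ({1..N} - {i})"
    have Ehs: "Eh i (Suc k) = At *\<^sub>v Eh i k + block_col m Bt i *\<^sub>v (block_row m K i *\<^sub>v Eh i k) + ?S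
        + L i *\<^sub>v (H i *\<^sub>v E k - H i *\<^sub>v Eh i k)"
      using obs i unfolding observer_dynamics_def by (simp add: ub)
    have fs: "?S \<in> carrier_vec (N * n)" "?S $ a = (\<Sum>l\<in>{1..N} - {i}. w l (Eh i k))"
      using wc[OF Eh[OF i]] a by (auto simp: w_def index_finsum_vec finsum_vec_closed)
    have c: "At *\<^sub>v Eh i k \<in> carrier_vec (N * n)" "At *\<^sub>v E k \<in> carrier_vec (N * n)"
      "L i *\<^sub>v (H i *\<^sub>v E k - H i *\<^sub>v Eh i k) \<in> carrier_vec (N * n)"
      "Bt *\<^sub>v block_vec N m (\<lambda>i. ub i k) \<in> carrier_vec (N * n)"
      using At Bt Li Hi E Eh[OF i] by (auto intro!: mult_mat_vec_carrier)
    have 1: "Eh i (Suc k) $ a = (At *\<^sub>v Eh i k) $ a + w i (Eh i k) + (\<Sum>l\<in>{1..N} - {i}. w l (Eh i k)) + hE"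
      unfolding Ehs fs(2)[symmetric] using a c fs(1) carrier_vecD[OF wc[OF Eh[OF i], of i]]
      by (simp add: w_def hE_def del: dim_mult_mat_vec index_mult_mat_vec)
    have "(Bt *\<^sub>v block_vec N m (\<lambda>i. ub i k)) $ a = (\<Sum>l\<in>{1..N}. (block_col m Bt l *\<^sub>v ub l k) $ a)"
      by (rule mult_block_vec_block_cols[OF Bt a]) (simp add: ub mult_mat_vec_carrier[OF br Eh])
    also have "\<dots> = (\<Sum>l\<in>{1..N}. w l (Eh l k))" by (simp add: w_def ub)
    finally have 2: "E (Suc k) $ a = (At *\<^sub>v E k) $ a + (\<Sum>l\<in>{1..N}. w l (Eh l k))"
      unfolding E_step using a c by (simp del: dim_mult_mat_vec index_mult_mat_vec)
    have 3: "(At *\<^sub>v ?eps i) $ a = (At *\<^sub>v Eh i k) $ a - (At *\<^sub>v E k) $ a"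
      using a c unfolding mult_minus_distrib_mat_vec[OF At Eh[OF i] E]
      by (simp del: dim_mult_mat_vec index_mult_mat_vec)
    \<comment> \<open>The common term \<open>E k\<close> drops out of the difference of two observer
      errors.\<close>
    have 4: "(\<Sum>l\<in>{1..N} - {i}. w l (?eps i)) - (\<Sum>l\<in>{1..N} - {i}. w l (?eps l))
        = (\<Sum>l\<in>{1..N} - {i}. w l (Eh i k)) - (\<Sum>l\<in>{1..N} - {i}. w l (Eh l k))"
      unfolding sum_subtractf[symmetric] using wd Eh E i by (intro sum.cong) auto
    have "(Eh i (Suc k) - E (Suc k)) $ a = Eh i (Suc k) $ a - E (Suc k) $ a"
      using a carrier_vecD[OF E, of "Suc k"] by simp
    then show ?thesis
      using 1 2 3 4 sum_split[of "\<lambda>l. w l (?eps i)"] sum_split[of "\<lambda>l. w l (Eh l k)"] by linarith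
  qed
  finally show "(?Ac *\<^sub>v block_vec N (N * n) ?eps) $ ((i - 1) * (N * n) + a) = (Eh i (Suc k) - E (Suc k)) $ a" .
qed

section \<open>Convergence of the closed loop\<close>

theorem theorem1:
  fixes N n m :: nat
    and A B R H L :: "nat \<Rightarrow> real mat"
    and q :: "nat \<Rightarrow> nat"
    and Q P At Bt Qt Rt K :: "real mat"
    and G :: "(nat \<times> nat) set"
    and par :: "nat \<Rightarrow> nat"
  assumes dims: "0 < N" "0 < n" "0 < m"
    and A: "\<And>i. i \<in> {0..N} \<Longrightarrow> A i \<in> carrier_mat n n"
    and B: "\<And>i. i \<in> {1..N} \<Longrightarrow> B i \<in> carrier_mat n m"
    and B0: "B 0 = 0\<^sub>m n m"
    and graph: "G \<subseteq> {0..N} \<times> {0..N}"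
    and tree: "rooted_spanning_tree N G par"
    and cases: "\<And>i. i \<in> {1..N} \<Longrightarrow> invertible_mat (B i) \<or>
          mat_range (hconcat (A (par i) - A i) (B (par i))) \<subseteq> mat_range (B i)"
    and H: "\<And>i. i \<in> {1..N} \<Longrightarrow>
          \<exists>F. (\<forall>a b. F a b \<in> {0\<^sub>m n n, 1\<^sub>m n}) \<and> H i = block_mat (q i) N n n F"
    and Q: "sym_pos_semidef n Q"
    and R: "\<And>i. i \<in> {1..N} \<Longrightarrow> sym_pos_def m (R i)"
    and At: "At = block_diag N A"
    and Bt: "Bt = block_diag N B"
    and Qt: "Qt = block_diag N (\<lambda>i. Q)"
    and Rt: "Rt = block_diag N R"
    and P: "P \<in> carrier_mat (N * n) (N * n)" "P\<^sup>T = P"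
    and inv: "invertible_mat (Rt + Bt\<^sup>T * P * Bt)"
    and riccati: "riccati_solution At Bt Qt Rt P"
    and K: "K = riccati_gain At Bt Rt P"
    and L: "\<And>i. i \<in> {1..N} \<Longrightarrow> L i \<in> carrier_mat (N * n) (q i * n)"
    and stable: "schur_stable (observer_error_mat N n m At Bt K L H)"
  shows "(\<forall>x Eh. closed_loop N n m A B par K L H x Eh \<longrightarrow>
            (\<forall>i \<in> {1..N}. (\<lambda>k. euclid_norm (Eh i k - stacked_error N n par x k)) \<longlonglongrightarrow> 0)) \<and>
         (sym_pos_def (N * n) P \<longrightarrow> (\<forall>i \<in> {1..N}. stabilizable n m (A i) (B i)) \<longrightarrow>
            (\<forall>x Eh. closed_loop N n m A B par K L H x Eh \<longrightarrow>
              (\<forall>i \<in> {1..N}. (\<lambda>k. euclid_norm (x i k - x 0 k)) \<longlonglongrightarrow> 0)))"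
proof (intro conjI allI impI)
  let ?D = "N * n"
  let ?E = "stacked_error N n par"
  have AN: "\<And>i. i \<in> {1..N} \<Longrightarrow> A i \<in> carrier_mat n n" using A by simp
  have B': "\<And>i. i \<in> {0..N} \<Longrightarrow> B i \<in> carrier_mat n m"
    using B B0 by (metis atLeastAtMost_iff less_one linorder_not_le zero_carrier_mat)
  have par: "\<And>i. i \<in> {1..N} \<Longrightarrow> par i \<in> {0..N}"
    using tree graph unfolding rooted_spanning_tree_def neighbours_def by fast
  have D: "0 < ?D" using dims by simp
  have Atc: "At \<in> carrier_mat ?D ?D" and Btc: "Bt \<in> carrier_mat ?D (N * m)"
    unfolding At Bt using AN B by (auto intro!: block_diag_carrier)
  have Qt_psd: "sym_pos_semidef ?D Qt" and Rt_pd: "sym_pos_def (N * m) Rt"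
    unfolding Qt Rt using Q R by (auto intro!: block_diag_pos_semidef block_diag_pos_def)
  have Kc: "K \<in> carrier_mat (N * m) ?D"
    using riccati_closed_loop(1)[OF Atc Btc _ _ P(1) inv riccati K] Qt_psd Rt_pd
    by (simp add: sym_pos_semidef_def sym_pos_def_def)
  have Hc: "H i \<in> carrier_mat (q i * n) ?D" if "i \<in> {1..N}" for i
    using H[OF that] by auto
  have Ec: "?E x k \<in> carrier_vec ?D" for x k by (simp add: stacked_error_def)

  \<comment> \<open>Collects what both claims need of a closed-loop trajectory: vanishing observer
    errors, the stacked error recursion, and the dimensions.\<close>
  have loop: "(\<forall>i\<in>{1..N}. (\<forall>k. Eh i k \<in> carrier_vec ?D) \<and> vanishing ?D (\<lambda>k. Eh i k - ?E x k)) \<and>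
      (\<forall>k. ?E x (Suc k) = At *\<^sub>v ?E x k + Bt *\<^sub>v block_vec N m (\<lambda>i. block_row m K i *\<^sub>v Eh i k)) \<and>
      (\<forall>i\<in>{0..N}. \<forall>k. x i k \<in> carrier_vec n)"
    if cl: "closed_loop N n m A B par K L H x Eh" for x Eh
  proof -
    from cl obtain u ut ub where dyn: "agent_dynamics N n m A B x u"
      and ff: "\<And>i. i \<in> {1..N} \<Longrightarrow>
        feedforward1 A B x u i (par i) (ut i) \<or> feedforward2 m A B x u i (par i) (ut i)"
      and ub: "\<And>i k. i \<in> {1..N} \<Longrightarrow> ub i k = block_row m K i *\<^sub>v Eh i k"
      and u: "\<And>i k. i \<in> {1..N} \<Longrightarrow> u i k = ut i k + ub i k"
      and obs: "observer_dynamics N n m At Bt K L H ub (?E x) Eh"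
      unfolding closed_loop_def At Bt by blast
    have Eh: "Eh i k \<in> carrier_vec ?D" if "i \<in> {1..N}" for i k
      using obs that unfolding observer_dynamics_def by blast
    have ubc: "ub i k \<in> carrier_vec m" if "i \<in> {1..N}" for i k
      unfolding ub[OF that] using block_row_carrier[OF Kc] Eh[OF that] by (rule mult_mat_vec_carrier)
    have E_step: "?E x (Suc k) = At *\<^sub>v ?E x k + Bt *\<^sub>v block_vec N m (\<lambda>i. ub i k)" for k
      unfolding At Bt by (rule stacked_error_step[OF A B' B0 par dyn ff ubc u])
    define Z where "Z k = block_vec N ?D (\<lambda>i. Eh i k - ?E x k)" for k
    let ?Ac = "observer_error_mat N n m At Bt K L H"
    have Acc: "?Ac \<in> carrier_mat (N * ?D) (N * ?D)" by (simp add: observer_error_mat_def)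
    have Zc: "Z k \<in> carrier_vec (N * ?D)" for k by (simp add: Z_def)
    have "Z (Suc k) = ?Ac *\<^sub>v Z k" for k
      unfolding Z_def by (rule observer_error_step[OF Atc Btc Kc Hc L Ec obs ub E_step])
    \<comment> \<open>A zero input is added so that the lemma on stable systems with vanishing input
      also covers the autonomous case.\<close>
    then have "Z (Suc k) = ?Ac *\<^sub>v Z k + 0\<^sub>v (N * ?D)" for k
      using mult_mat_vec_carrier[OF Acc Zc] by simp
    then have "vanishing (N * ?D) Z"
      using schur_stable_vanishing_input[OF Acc _ stable Zc, of "\<lambda>k. 0\<^sub>v (N * ?D)"] D dims
      by (simp add: vanishing_def)
    then have "vanishing ?D (\<lambda>k. Eh i k - ?E x k)" if "i \<in> {1..N}" for i
      using vanishing_block_vecD[of N ?D "\<lambda>i k. Eh i k - ?E x k"] that by (simp add: Z_def[abs_def])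
    moreover have "block_vec N m (\<lambda>i. ub i k) = block_vec N m (\<lambda>i. block_row m K i *\<^sub>v Eh i k)" for k
      by (rule block_vec_cong) (rule ub)
    moreover have "x i k \<in> carrier_vec n" if "i \<in> {0..N}" for i k
      using dyn that by (cases "i = 0") (auto simp: agent_dynamics_def)
    ultimately show ?thesis using E_step Eh by simp
  qed

  show "\<forall>i\<in>{1..N}. (\<lambda>k. euclid_norm (Eh i k - ?E x k)) \<longlonglongrightarrow> 0"
    if "closed_loop N n m A B par K L H x Eh" for x Eh
  proof
    fix i assume "i \<in> {1..N}"
    with loop[OF that] Ec show "(\<lambda>k. euclid_norm (Eh i k - ?E x k)) \<longlonglongrightarrow> 0"
      by (intro vanishing_euclid_norm[of _ ?D]) auto
  qed

  show "\<forall>i\<in>{1..N}. (\<lambda>k. euclid_norm (x i k - x 0 k)) \<longlonglongrightarrow> 0"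
    if P_pd: "sym_pos_def ?D P" and stab: "\<forall>i\<in>{1..N}. stabilizable n m (A i) (B i)"
      and cl: "closed_loop N n m A B par K L H x Eh" for x Eh
  proof -
    note lp = loop[OF cl]
    have xc: "x i k \<in> carrier_vec n" if "i \<in> {0..N}" for i k using lp that by blast
    have Eh: "Eh i k \<in> carrier_vec ?D" if "i \<in> {1..N}" for i k using lp that by blast
    have BKc: "Bt * K \<in> carrier_mat ?D ?D" using Btc Kc by auto
    then have Mc: "At + Bt * K \<in> carrier_mat ?D ?D" by simp
    \<comment> \<open>Here the definiteness of \<open>P\<close> and the stabilizability of the
      single agents enter.\<close>
    have M: "schur_stable (At + Bt * K)"
    proof (rule riccati_gain_schur_stable[OF D Atc Btc Qt_psd Rt_pd P_pd inv riccati K])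
      fix w c
      assume "w \<in> carrier_vec ?D" "w \<noteq> 0\<^sub>v ?D"
        "cmat At\<^sup>T *\<^sub>v w = c \<cdot>\<^sub>v w" "cmat Bt\<^sup>T *\<^sub>v w = 0\<^sub>v (N * m)"
      then show "cmod c < 1"
        unfolding At Bt using block_diag_stabilizable_modes[of n N A B m w c] dims AN B stab by blast
    qed
    define eps where "eps i k = Eh i k - ?E x k" for i k
    have eps: "eps i k \<in> carrier_vec ?D" "vanishing ?D (eps i)" if "i \<in> {1..N}" for i k
      using lp that Ec unfolding eps_def by auto
    \<comment> \<open>The agents feed back different estimates of the same error; \<open>d\<close>
      is the deviation from the central feedback K E and vanishes with the observer errors.\<close>
    define d where "d k = Bt *\<^sub>v block_vec N m (\<lambda>i. block_row m K i *\<^sub>v eps i k)" for k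
    have dc: "d k \<in> carrier_vec ?D" for k
      unfolding d_def using Btc block_vec_carrier by (rule mult_mat_vec_carrier)
    have br: "block_row m K i \<in> carrier_mat m ?D" for i using Kc by (rule block_row_carrier)
    have "vanishing ?D d"
      unfolding d_def using eps br
      by (intro vanishing_mult_mat_vec[OF Btc block_vec_carrier] vanishing_block_vecI
          vanishing_mult_mat_vec[OF br]) auto
    moreover have "?E x (Suc k) = (At + Bt * K) *\<^sub>v ?E x k + d k" for k
    proof -
      have KE: "K *\<^sub>v ?E x k \<in> carrier_vec (N * m)" using Kc Ec by (rule mult_mat_vec_carrier)
      have "K *\<^sub>v ?E x k + block_vec N m (\<lambda>i. block_row m K i *\<^sub>v eps i k)
          = block_vec N m (\<lambda>i. block_row m K i *\<^sub>v ?E x k + block_row m K i *\<^sub>v eps i k)"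
        unfolding mult_mat_vec_block_rows[OF Kc Ec]
        using mult_mat_vec_carrier[OF br eps(1)] by (rule block_vec_add)
      also have "\<dots> = block_vec N m (\<lambda>i. block_row m K i *\<^sub>v Eh i k)"
      proof (rule block_vec_cong)
        fix i assume i: "i \<in> {1..N}"
        have c: "block_row m K i *\<^sub>v Eh i k \<in> carrier_vec m" "block_row m K i *\<^sub>v ?E x k \<in> carrier_vec m"
          using mult_mat_vec_carrier[OF br Eh[OF i]] mult_mat_vec_carrier[OF br Ec] by auto
        show "block_row m K i *\<^sub>v ?E x k + block_row m K i *\<^sub>v eps i k = block_row m K i *\<^sub>v Eh i k"
          unfolding eps_def mult_minus_distrib_mat_vec[OF br Eh[OF i] Ec]
          using c by (intro eq_vecI) auto
      qed
      finally have "?E x (Suc k) = At *\<^sub>v ?E x k + Bt *\<^sub>v (K *\<^sub>v ?E x k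
          + block_vec N m (\<lambda>i. block_row m K i *\<^sub>v eps i k))"
        using lp by simp
      also have "\<dots> = At *\<^sub>v ?E x k + (Bt *\<^sub>v (K *\<^sub>v ?E x k) + d k)"
        unfolding d_def mult_add_distrib_mat_vec[OF Btc KE block_vec_carrier] ..
      also have "\<dots> = (At + Bt * K) *\<^sub>v ?E x k + d k"
        unfolding add_mult_distrib_mat_vec[OF Atc BKc Ec] assoc_mult_mat_vec[OF Btc Kc Ec]
        using mult_mat_vec_carrier[OF Atc Ec] mult_mat_vec_carrier[OF Btc KE] dc
        by (rule assoc_add_vec[symmetric])
      finally show ?thesis .
    qed
    ultimately have "vanishing ?D (?E x)"
      using schur_stable_vanishing_input[where v = "?E x" and d = d, OF Mc D M Ec dc] by blast
    then have e: "vanishing n (\<lambda>k. x i k - x (par i) k)" if "i \<in> {1..N}" for i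
      using vanishing_block_vecD[of N n "\<lambda>i k. x i k - x (par i) k"] that
      by (simp add: stacked_error_def[abs_def])
    \<comment> \<open>Along the tree path from the root, the error to the leader is the sum of the
      parent errors on its arcs, which suggests induction on the path.\<close>
    have "vanishing n (\<lambda>k. x i k - x 0 k)" if "(0, i) \<in> {(par l, l) |l. l \<in> {1..N}}\<^sup>*" for i
      using that
    proof (induction rule: rtrancl_induct)
      case base
      have "x 0 k - x 0 k = 0\<^sub>v n" for k using xc[of 0 k] by simp
      then show ?case by (simp add: vanishing_def)
    next
      case (step j l)
      then have l: "l \<in> {1..N}" and j: "j = par l" by auto
      have c: "x l k \<in> carrier_vec n" "x j k \<in> carrier_vec n" "x 0 k \<in> carrier_vec n" for k
        using xc l par[OF l] j by auto
      have "vanishing n (\<lambda>k. (x l k - x j k) + (x j k - x 0 k))"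
        using e[OF l] step.IH c unfolding j by (intro vanishing_add) auto
      moreover have "(x l k - x j k) + (x j k - x 0 k) = x l k - x 0 k" for k
        using c[of k] by (intro eq_vecI) auto
      ultimately show ?case by simp
    qed
    then have "vanishing n (\<lambda>k. x i k - x 0 k)" if "i \<in> {1..N}" for i
      using tree that unfolding rooted_spanning_tree_def by blast
    then show ?thesis using xc by (intro ballI vanishing_euclid_norm[of _ n]) auto
  qed
qed

end
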